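(* Let $f:\mathbb{R}^d\to\mathbb{R}$ be as in the context, with unique global minimizer $x^*$. Let $\alpha,\lambda,\delta>0$ be fixed, $T>0$ given, and let $\rho^\alpha$ be a smooth solution on $[0,T]$ of $$\partial_t\rho^\alpha_t(x) = \lambda\, \mathrm{div}\big(\rho^\alpha_t(x)(x-X^\alpha(\rho^\alpha_t))\big) +\frac{\delta^2}{2}\Delta \rho^\alpha_t(x).$$ Let $\boldsymbol\rho_\infty=\mathcal N\big(x^*,\tfrac{\delta^2}{2\lambda}I_d\big)$. Then $$\frac{d}{dt}\mathcal H(\rho^\alpha_t\mid\boldsymbol\rho_\infty)\le-\frac{\delta^2}{2}\mathcal I(\rho^\alpha_t\mid\boldsymbol\rho_\infty)+\lambda|X^\alpha(\rho^\alpha_t)-x^*|\,\mathcal I(\rho^\alpha_t\mid\boldsymbol\rho_\infty)^{1/2}.$$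
   Context: For a probability measure $\rho$ on $\mathbb{R}^d$ and $\alpha>0$, the consensus point is $X^\alpha(\rho)=\frac{\int x e^{-\alpha f(x)}d\rho(x)}{\int e^{-\alpha f(x)}d\rho(x)}$. Relative entropy and Fisher information: $\mathcal H(\rho\mid\nu)=\int\log(\rho/\nu)\rho\,dx$, $\mathcal I(\rho\mid\nu)=\int|\nabla\log(\rho/\nu)|^2\rho\,dx$. Smooth solutions $\rho^\alpha\in L^\infty(0,T;H^k(\mathbb{R}^d))$, $k\ge2$, are available when $\rho_0\in L^1\cap H^k\cap\mathcal P_4(\mathbb{R}^d)$; smoothness is understood to justify the usual differentiation and integration by parts. Standing assumption on $f$: $f$ is continuous and there is a unique $x^*\in\mathbb{R}^d$ with $f(x^* )=\min f=:\underline f$; there is $L_f>0$ with $|f(x)-f(y)|\le L_f(1+|x|+|y|)|x-y|$ for all $x,y$; and there are $c_\ell,c_u,M>0$ with $f(x)-\underline f\le c_u(|x|^2+1)$ for all $x$ and $c_\ell|x|^2\le f(x)-\underline f$ for $|x|\ge M$. *)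

theory Defs
  imports "HOL-Probability.Probability"
begin

text \<open>
  A probability measure with a Lebesgue density on the Euclidean space \<open>'a\<close> (of dimension
  \<open>DIM('a)\<close>) is represented by the density \<open>\<rho>\<close>; the measure is
  \<open>density lborel (\<lambda>x. ennreal (\<rho> x))\<close>.
\<close>

definition gradient :: "('a::euclidean_space \<Rightarrow> real) \<Rightarrow> 'a \<Rightarrow> 'a" where
  "gradient g x = (\<Sum>i\<in>Basis. frechet_derivative g (at x) i *\<^sub>R i)"

definition divergence :: "('a::euclidean_space \<Rightarrow> 'a) \<Rightarrow> 'a \<Rightarrow> real" where
  "divergence F x = (\<Sum>i\<in>Basis. frechet_derivative F (at x) i \<bullet> i)"

definition laplacian :: "('a::euclidean_space \<Rightarrow> real) \<Rightarrow> 'a \<Rightarrow> real" where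
  "laplacian g x = divergence (gradient g) x"

definition objective_function :: "('a::euclidean_space \<Rightarrow> real) \<Rightarrow> 'a \<Rightarrow> bool" where
  "objective_function f xmin \<longleftrightarrow>
     continuous_on UNIV f \<and>
     (\<forall>x. f xmin \<le> f x) \<and> (\<forall>y. (\<forall>x. f y \<le> f x) \<longrightarrow> y = xmin) \<and>
     (\<exists>L>0. \<forall>x y. \<bar>f x - f y\<bar> \<le> L * (1 + norm x + norm y) * norm (x - y)) \<and>
     (\<exists>cl>0. \<exists>cu>0. \<exists>M>0.
        (\<forall>x. f x - f xmin \<le> cu * ((norm x)\<^sup>2 + 1)) \<and>
        (\<forall>x. norm x \<ge> M \<longrightarrow> cl * (norm x)\<^sup>2 \<le> f x - f xmin))"

definition consensus_point ::
    "('a::euclidean_space \<Rightarrow> real) \<Rightarrow> real \<Rightarrow> 'a measure \<Rightarrow> 'a" where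
  "consensus_point f \<alpha> \<mu> =
     (LINT x|\<mu>. exp (- \<alpha> * f x) *\<^sub>R x) /\<^sub>R (LINT x|\<mu>. exp (- \<alpha> * f x))"

abbreviation measure_of_density :: "('a::euclidean_space \<Rightarrow> real) \<Rightarrow> 'a measure" where
  "measure_of_density \<rho> \<equiv> density lborel (\<lambda>x. ennreal (\<rho> x))"

text \<open>The density of the Gaussian with mean \<open>m\<close> and covariance \<open>v\<close> times the identity
  (\<open>v\<close> is the variance, not the standard deviation).\<close>

definition gaussian_density :: "'a::euclidean_space \<Rightarrow> real \<Rightarrow> 'a \<Rightarrow> real" where
  "gaussian_density m v x =
     (2 * pi * v) powr (- real DIM('a) / 2) * exp (- (norm (x - m))\<^sup>2 / (2 * v))"

text \<open>The Bochner integral below is \<open>0\<close> by convention when the integrand is not integrable,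
  so integrability has to be stated alongside it. The Fisher information takes values in
  \<open>[0, \<infinity>]\<close>.\<close>

definition relative_entropy ::
    "('a::euclidean_space \<Rightarrow> real) \<Rightarrow> ('a \<Rightarrow> real) \<Rightarrow> real" where
  "relative_entropy \<rho> \<nu> = (LINT x|lborel. ln (\<rho> x / \<nu> x) * \<rho> x)"

definition fisher_information ::
    "('a::euclidean_space \<Rightarrow> real) \<Rightarrow> ('a \<Rightarrow> real) \<Rightarrow> ennreal" where
  "fisher_information \<rho> \<nu> =
     (\<integral>\<^sup>+x. ennreal ((norm (gradient (\<lambda>y. ln (\<rho> y / \<nu> y)) x))\<^sup>2 * \<rho> x) \<partial>lborel)"

definition fokker_planck_rhs ::
    "('a::euclidean_space \<Rightarrow> real) \<Rightarrow> real \<Rightarrow> real \<Rightarrow> real \<Rightarrow> ('a \<Rightarrow> real) \<Rightarrow> 'a \<Rightarrow> real" where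
  "fokker_planck_rhs f \<alpha> lam \<delta> \<rho> x =
     lam * divergence (\<lambda>y. \<rho> y *\<^sub>R (y - consensus_point f \<alpha> (measure_of_density \<rho>))) x
     + \<delta>\<^sup>2 / 2 * laplacian \<rho> x"

text \<open>
  A smooth solution is a classical, strictly positive solution for positive times, whose time
  slices are square-integrable probability densities with finite second moment. Nothing is
  required at time \<open>0\<close>, where the initial density may vanish on a set of positive measure.
  At the right end point \<open>T\<close> the time derivative is one-sided.

  Smoothness is also meant to justify differentiating entropies under the integral sign. This
  is the last clause: the time derivative of \<open>\<rho>\<close>, which is \<open>fokker_planck_rhs\<close>, multiplied by
  the weight \<open>1 + |x|^2 + |ln \<rho>|\<close>, has an integrable majorant that is uniform in time away from
  \<open>0\<close>. No integration by parts formula and no bound on the Fisher information is assumed.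
\<close>

definition smooth_solution ::
    "('a::euclidean_space \<Rightarrow> real) \<Rightarrow> real \<Rightarrow> real \<Rightarrow> real \<Rightarrow> real \<Rightarrow> (real \<Rightarrow> 'a \<Rightarrow> real) \<Rightarrow> bool" where
  "smooth_solution f \<alpha> lam \<delta> T \<rho> \<longleftrightarrow>
     (\<forall>t\<in>{0<..T}.
        (\<forall>x. 0 < \<rho> t x) \<and>
        prob_space (measure_of_density (\<rho> t)) \<and>
        integrable lborel (\<lambda>x. (norm x)\<^sup>2 * \<rho> t x) \<and>
        integrable lborel (\<lambda>x. (\<rho> t x)\<^sup>2)) \<and>
     (\<forall>t\<in>{0<..T}. \<forall>x.
        (\<rho> t) differentiable (at x) \<and> (gradient (\<rho> t)) differentiable (at x)) \<and>
     continuous_on ({0<..T} \<times> UNIV) (\<lambda>(t, x). \<rho> t x) \<and>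
     continuous_on ({0<..T} \<times> UNIV) (\<lambda>(t, x). gradient (\<rho> t) x) \<and>
     (\<forall>i\<in>Basis. continuous_on ({0<..T} \<times> UNIV)
        (\<lambda>(t, x). frechet_derivative (gradient (\<rho> t)) (at x) i)) \<and>
     (\<forall>t\<in>{0<..T}. \<forall>x.
        ((\<lambda>s. \<rho> s x) has_real_derivative fokker_planck_rhs f \<alpha> lam \<delta> (\<rho> t) x)
          (at t within {0<..T})) \<and>
     (\<forall>t0\<in>{0<..T}. \<exists>g. integrable lborel g \<and>
        (\<forall>t\<in>{t0..T}. \<forall>x.
           \<bar>fokker_planck_rhs f \<alpha> lam \<delta> (\<rho> t) x\<bar> * (1 + (norm x)\<^sup>2 + \<bar>ln (\<rho> t x)\<bar>) \<le> g x))"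

end

theory Submission
  imports Defs
begin

text \<open>
  Write \<open>h = ln (\<rho> / \<rho>inf)\<close>, \<open>w\<close> for the gradient of \<open>h\<close>, \<open>v = \<delta>\<^sup>2 / (2 lam)\<close>, \<open>a = \<delta>\<^sup>2 / 2\<close>, \<open>m\<close> for the
  consensus point and \<open>b = (xmin - m) / v\<close>. The right-hand side of the equation is the divergence of
  the flux \<open>J = a \<rho> (w + b)\<close>, so formally the entropy has derivative
  \<open>\<integral> h div J = - a \<integral> \<rho> |w|\<^sup>2 - a \<integral> \<rho> w \<bullet> b\<close>, and the Cauchy-Schwarz inequality bounds the last term.

  The integration by parts is justified with the cutoffs \<open>\<psi> = (1 - |x|\<^sup>2 / N\<^sup>2)\<^sub>+\<^sup>2\<close>, for which
  \<open>|grad \<psi>| \<le> 4 sqrt \<psi> / N\<close>. The boundary term \<open>a \<integral> \<rho> h (w + b) \<bullet> grad \<psi>\<close> is absorbed with Young's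
  inequality into \<open>\<integral> \<psi> \<rho> |w|\<^sup>2\<close> and \<open>\<integral>\<^bsub>|x| \<le> N\<^esub> \<rho> h\<^sup>2 / N\<^sup>2\<close>. The latter is bounded although only
  second moments are finite, because \<open>h\<^sup>2\<close> grows like \<open>|x|\<^sup>4\<close> and \<open>|x|\<^sup>4 / N\<^sup>2 \<le> |x|\<^sup>2\<close> there. Fatou's lemma
  then gives finite Fisher information, after which dominated convergence removes the cutoff.
\<close>

section \<open>Integrability criteria and compactly supported derivatives\<close>

text \<open>The integrand factorises over the coordinates and \<open>lborel\<close> is the image of
  a product of one-dimensional Lebesgue measures, so the standard normal density on the line
  suffices. This Gaussian later dominates the logarithmic terms where a density is tiny.\<close>

lemma integrable_exp_neg_norm_square:
  "integrable lborel (\<lambda>x::'a::euclidean_space. exp (- (norm x)\<^sup>2 / 2))"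
proof -
  interpret product_sigma_finite "\<lambda>_::'a. lborel :: real measure"
    by (simp add: product_sigma_finite_def lborel.sigma_finite_measure_axioms)
  have one: "integrable lborel (\<lambda>y::real. exp (- y\<^sup>2 / 2))"
  proof -
    have "integrable lborel (\<lambda>y. sqrt (2 * pi) * std_normal_density y)"
      by (intro integrable_mult_right integrable_normal_density) simp
    then show ?thesis
      by (simp add: std_normal_density_def)
  qed
  have exp_eq: "exp (- (norm x)\<^sup>2 / 2) = (\<Prod>b\<in>Basis. exp (- (x \<bullet> b)\<^sup>2 / 2))" for x :: 'a
    unfolding power2_norm_eq_inner euclidean_inner[of x x]
    by (simp add: exp_sum[symmetric] sum_negf sum_divide_distrib[symmetric] power2_eq_square)
  have "integrable (Pi\<^sub>M Basis (\<lambda>_::'a. lborel :: real measure))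
      (\<lambda>y. \<Prod>b\<in>Basis. exp (- (y b)\<^sup>2 / 2))"
    by (rule product_integrable_prod) (use one in simp_all)
  moreover have "(\<Prod>b\<in>Basis. exp (- ((\<Sum>c\<in>Basis. y c *\<^sub>R c) \<bullet> b)\<^sup>2 / 2))
      = (\<Prod>b\<in>Basis. exp (- (y b)\<^sup>2 / 2))" for y :: "'a \<Rightarrow> real"
    by (intro prod.cong refl) simp
  ultimately show ?thesis
    unfolding exp_eq
    by (subst lborel_def, subst integrable_distr_eq) (simp_all add: lborel_eq_real[symmetric])
qed

lemma integrable_continuous_compact_support:
  fixes F :: "'a::euclidean_space \<Rightarrow> real"
  assumes "continuous_on UNIV F" and "\<And>x. r < norm x \<Longrightarrow> F x = 0"
  shows "integrable lborel F"
proof -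
  have "integrable lborel (\<lambda>x. indicator (cball 0 r) x *\<^sub>R F x)"
    using assms(1) by (intro borel_integrable_compact continuous_on_subset[OF assms(1)]) auto
  also have "(\<lambda>x. indicator (cball 0 r) x *\<^sub>R F x) = F"
    using assms(2) by (auto simp: fun_eq_iff indicator_def)
  finally show ?thesis .
qed

text \<open>By translation invariance of the Lebesgue measure all difference quotients of \<open>F\<close> have
  integral zero.\<close>

lemma integral_directional_derivative_eq_0:
  fixes F :: "'a::euclidean_space \<Rightarrow> real"
  assumes der: "\<And>x. (F has_derivative F' x) (at x)"
    and cont: "continuous_on UNIV (\<lambda>x. F' x e)"
    and supp: "\<And>x. r < norm x \<Longrightarrow> F x = 0"
  shows "(LINT x|lborel. F' x e) = 0"
proof -
  have F_cont: "continuous_on UNIV F"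
    using der by (meson has_derivative_continuous continuous_at_imp_continuous_on)
  have F_int: "integrable lborel F"
    by (rule integrable_continuous_compact_support[OF F_cont supp])
  have [measurable]: "F \<in> borel_measurable borel"
    by (rule borel_measurable_continuous_onI[OF F_cont])
  have [measurable]: "(\<lambda>x. F' x e) \<in> borel_measurable borel"
    by (rule borel_measurable_continuous_onI[OF cont])
  \<comment> \<open>The difference quotients use steps of length at most |e|. They can be nonzero
    only at points of norm at most |r| + |e|, and a segment of length |e| issuing from such a point
    stays in \<open>K\<close>. The absolute value covers a negative \<open>r\<close>.\<close>
  define K where "K = cball (0::'a) (\<bar>r\<bar> + 2 * norm e)"
  have "compact ((\<lambda>x. F' x e) ` K)"
    unfolding K_def by (intro compact_continuous_image continuous_on_subset[OF cont]) auto
  then obtain B where B: "\<And>x. x \<in> K \<Longrightarrow> \<bar>F' x e\<bar> \<le> B"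
    by (meson bounded_real compact_imp_bounded imageI)
  have B0: "0 \<le> B"
    using B[of 0] by (force simp: K_def)
  define q where "q n x = (F (x + (1 / real (Suc n)) *\<^sub>R e) - F x) * real (Suc n)" for n x
  have line: "((\<lambda>s. F (x + s *\<^sub>R e)) has_real_derivative F' (x + s *\<^sub>R e) e) (at s within S)" for x s S
  proof -
    have "((\<lambda>s. F (x + s *\<^sub>R e)) has_derivative (\<lambda>u. F' (x + s *\<^sub>R e) (u *\<^sub>R e))) (at s)"
      by (rule has_derivative_compose[OF _ der, where f="\<lambda>s. x + s *\<^sub>R e"])
         (auto intro!: derivative_eq_intros)
    moreover have "F' (x + s *\<^sub>R e) (u *\<^sub>R e) = F' (x + s *\<^sub>R e) e * u" for u
      using linear_cmul[OF has_derivative_linear[OF der]] by (simp add: mult.commute)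
    ultimately have "((\<lambda>s. F (x + s *\<^sub>R e)) has_real_derivative F' (x + s *\<^sub>R e) e) (at s)"
      by (simp add: has_field_derivative_def)
    then show ?thesis
      by (rule has_field_derivative_at_within)
  qed
  have bound: "\<bar>q n x\<bar> \<le> B * indicator (cball 0 (\<bar>r\<bar> + norm e)) x" for n x
  proof (cases "norm x \<le> \<bar>r\<bar> + norm e")
    case True
    have "norm (F (x + (1 / real (Suc n)) *\<^sub>R e) - F (x + 0 *\<^sub>R e)) \<le> B * norm (1 / real (Suc n) - 0)"
    proof (rule field_differentiable_bound[where S="{0..1}" and f="\<lambda>s. F (x + s *\<^sub>R e)"])
      fix s :: real assume s: "s \<in> {0..1}"
      have "norm (x + s *\<^sub>R e) \<le> norm x + \<bar>s\<bar> * norm e"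
        by (metis norm_scaleR norm_triangle_ineq)
      also have "\<dots> \<le> \<bar>r\<bar> + norm e + 1 * norm e"
        using s True by (intro add_mono mult_right_mono) auto
      finally show "norm (F' (x + s *\<^sub>R e) e) \<le> B"
        by (auto intro!: B simp: K_def)
    qed (auto intro: line)
    then have "\<bar>F (x + (1 / real (Suc n)) *\<^sub>R e) - F x\<bar> \<le> B / real (Suc n)"
      by simp
    then show ?thesis
      using True unfolding q_def by (simp add: abs_mult pos_le_divide_eq del: of_nat_Suc)
  next
    case False
    have "(1 / real (Suc n)) * norm e \<le> 1 * norm e"
      by (intro mult_right_mono) auto
    moreover have "norm x \<le> norm (x + (1 / real (Suc n)) *\<^sub>R e) + norm ((1 / real (Suc n)) *\<^sub>R e)"
      using norm_triangle_ineq4[of "x + (1 / real (Suc n)) *\<^sub>R e" "(1 / real (Suc n)) *\<^sub>R e"] by simp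
    moreover have "norm ((1 / real (Suc n)) *\<^sub>R e) = (1 / real (Suc n)) * norm e"
      by (simp del: of_nat_Suc)
    ultimately have "r < norm (x + (1 / real (Suc n)) *\<^sub>R e)"
      using False abs_ge_self[of r] by linarith
    moreover have "r < norm x"
      using False norm_ge_zero[of e] abs_ge_self[of r] by linarith
    ultimately
    show ?thesis
      using False supp by (simp add: q_def)
  qed
  have lim: "(\<lambda>n. q n x) \<longlonglongrightarrow> F' x e" for x
  proof -
    have "((\<lambda>s. (F (x + s *\<^sub>R e) - F x) / s) \<longlongrightarrow> F' x e) (at 0)"
      using line[of x 0 UNIV] by (simp add: has_field_derivative_iff)
    moreover have "filterlim (\<lambda>n. 1 / real (Suc n)) (at 0) sequentially"
      using LIMSEQ_inverse_real_of_nat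
      by (auto simp: filterlim_at inverse_eq_divide eventually_sequentially)
    ultimately have "(\<lambda>n. (F (x + (1 / real (Suc n)) *\<^sub>R e) - F x) / (1 / real (Suc n))) \<longlonglongrightarrow> F' x e"
      by (rule filterlim_compose)
    then show ?thesis
      by (simp add: q_def)
  qed
  have shift: "integrable lborel (\<lambda>x. F (c + x)) \<and> (LINT x|lborel. F (c + x)) = (LINT x|lborel. F x)" for c
  proof -
    have "integrable (distr lborel borel ((+) c)) F"
      using F_int by (simp add: lborel_distr_plus)
    moreover have "(LINT x|distr lborel borel ((+) c). F x) = (LINT x|lborel. F x)"
      by (simp add: lborel_distr_plus)
    ultimately show ?thesis
      by (simp add: integrable_distr_eq integral_distr)
  qed
  have "(LINT x|lborel. q n x) = 0" for n
    using shift[of "(1 / real (Suc n)) *\<^sub>R e"] F_int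
    by (simp add: q_def add.commute)
  moreover have "(\<lambda>n. LINT x|lborel. q n x) \<longlonglongrightarrow> (LINT x|lborel. F' x e)"
  proof (rule integral_dominated_convergence)
    show "integrable lborel (\<lambda>x. B * indicator (cball 0 (\<bar>r\<bar> + norm e)) x)"
      by (intro integrable_mult_right integrable_real_indicator emeasure_bounded_finite) auto
    show "q n \<in> borel_measurable lborel" for n
      unfolding q_def[abs_def] by measurable
    show "AE x in lborel. (\<lambda>n. q n x) \<longlonglongrightarrow> F' x e"
      using lim by (intro AE_I2)
    show "AE x in lborel. norm (q n x) \<le> B * indicator (cball 0 (\<bar>r\<bar> + norm e)) x" for n
      unfolding real_norm_def using bound by (intro AE_I2)
  qed simp
  ultimately have "(\<lambda>n::nat. 0) \<longlonglongrightarrow> (LINT x|lborel. F' x e)"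
    by simp
  then show ?thesis
    using LIMSEQ_unique tendsto_const by blast
qed

section \<open>Differentiation under the integral sign\<close>

text \<open>The mean value inequality bounds the difference quotients by \<open>g\<close>, and
  dominated convergence applies along every sequence tending to \<open>t\<close>. The majorant lives
  on \<open>{t0..T}\<close> with \<open>t0 < t\<close>, which fits a solution that is controlled
  uniformly only away from time 0; at \<open>t = T\<close> the derivative is one-sided.\<close>

lemma has_real_derivative_integral:
  fixes \<phi> :: "real \<Rightarrow> 'a \<Rightarrow> real"
  assumes der: "\<And>s x. s \<in> {0<..T} \<Longrightarrow> ((\<lambda>s. \<phi> s x) has_real_derivative \<phi>' s x) (at s within {0<..T})"
    and int: "\<And>s. s \<in> {0<..T} \<Longrightarrow> integrable M (\<phi> s)"
    and meas: "\<phi>' t \<in> borel_measurable M"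
    and t: "t \<in> {0<..T}" "t0 \<in> {0<..<t}"
    and g: "integrable M g" "\<And>s x. s \<in> {t0..T} \<Longrightarrow> \<bar>\<phi>' s x\<bar> \<le> g x"
  shows "((\<lambda>s. LINT x|M. \<phi> s x) has_real_derivative (LINT x|M. \<phi>' t x)) (at t within {0<..T})"
  unfolding has_field_derivative_iff tendsto_at_iff_sequentially comp_def
proof (intro allI impI)
  fix X :: "nat \<Rightarrow> real"
  assume X: "\<forall>i. X i \<in> {0<..T} - {t}" and lim: "X \<longlonglongrightarrow> t"
  define Q where "Q s x = (\<phi> s x - \<phi> t x) / (s - t)" for s x
  have "\<forall>\<^sub>F n in sequentially. t0 < X n"
    using lim t(2) by (auto intro: order_tendstoD(1))
  \<comment> \<open>Dropping the first \<open>N\<close> terms puts the whole sequence into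
    \<open>{t0..T}\<close>, where the majorant holds.\<close>
  then obtain N where N: "\<And>n. t0 < X (n + N)"
    unfolding eventually_sequentially by (meson le_add2)
  have "(\<lambda>n. LINT x|M. Q (X (n + N)) x) \<longlonglongrightarrow> (LINT x|M. \<phi>' t x)"
  proof (rule integral_dominated_convergence)
    show "Q (X (n + N)) \<in> borel_measurable M" for n
    proof -
      have [measurable]: "\<phi> (X (n + N)) \<in> borel_measurable M" "\<phi> t \<in> borel_measurable M"
        using X t(1) by (auto intro!: borel_measurable_integrable int)
      show ?thesis
        unfolding Q_def by measurable
    qed
    show "AE x in M. (\<lambda>n. Q (X (n + N)) x) \<longlonglongrightarrow> \<phi>' t x"
    proof (intro AE_I2)
      fix x
      have "(\<lambda>n. Q (X n) x) \<longlonglongrightarrow> \<phi>' t x"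
        using der[OF t(1), of x] X lim
        unfolding has_field_derivative_iff tendsto_at_iff_sequentially comp_def Q_def by blast
      then show "(\<lambda>n. Q (X (n + N)) x) \<longlonglongrightarrow> \<phi>' t x"
        by (rule LIMSEQ_ignore_initial_segment)
    qed
    show "AE x in M. norm (Q (X (n + N)) x) \<le> g x" for n
    proof (intro AE_I2)
      fix x
      have "norm (\<phi> (X (n + N)) x - \<phi> t x) \<le> g x * norm (X (n + N) - t)"
      proof (rule field_differentiable_bound[where S="{t0..T}"])
        show "((\<lambda>s. \<phi> s x) has_real_derivative \<phi>' s x) (at s within {t0..T})" if "s \<in> {t0..T}" for s
          by (rule DERIV_subset[OF der]) (use that t in auto)
        show "X (n + N) \<in> {t0..T}"
          using X[rule_format, of "n + N"] N[of n] by auto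
      qed (use t g in auto)
      then show "norm (Q (X (n + N)) x) \<le> g x"
        using X[rule_format, of "n + N"] by (simp add: Q_def abs_divide divide_le_eq)
    qed
  qed (use meas g in auto)
  moreover have "(LINT x|M. Q (X n) x) = ((LINT x|M. \<phi> (X n) x) - (LINT x|M. \<phi> t x)) / (X n - t)" for n
    using int X t(1) unfolding Q_def by (subst integral_divide_zero) (simp add: Bochner_Integration.integral_diff)
  ultimately have "(\<lambda>n. ((LINT x|M. \<phi> (X (n + N)) x) - (LINT x|M. \<phi> t x)) / (X (n + N) - t))
      \<longlonglongrightarrow> (LINT x|M. \<phi>' t x)"
    by (simp only:)
  then show "(\<lambda>n. ((LINT x|M. \<phi> (X n) x) - (LINT x|M. \<phi> t x)) / (X n - t)) \<longlonglongrightarrow> (LINT x|M. \<phi>' t x)"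
    by (rule LIMSEQ_offset)
qed

section \<open>Elementary bounds on r |ln r| and r (ln r)^2\<close>

text \<open>For \<open>r < 1\<close> the two bounds below distinguish whether \<open>- ln r \<le> z\<^sup>2\<close>.\<close>

lemma x_ln_square_bound:
  fixes r z :: real
  assumes "0 < r"
  shows "r * (ln r)\<^sup>2 \<le> r * z ^ 4 + 4 * r\<^sup>2 + 16 * exp (- z\<^sup>2 / 2)"
proof (cases "1 \<le> r")
  case True
  \<comment> \<open>Passing to the square root gives (ln r)^2 \<le> 4 r, so that large values of a
    density are controlled by its square.\<close>
  have "ln r = 2 * ln (sqrt r)"
    using assms by (simp add: ln_sqrt)
  moreover have "ln (sqrt r) \<le> sqrt r - 1"
    using assms by (intro ln_le_minus_one) simp
  ultimately have "(ln r)\<^sup>2 \<le> (2 * sqrt r)\<^sup>2"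
    using True by (intro power_mono) auto
  then have "r * (ln r)\<^sup>2 \<le> r * (4 * r)"
    using assms by (intro mult_left_mono) (auto simp: power_mult_distrib)
  moreover have "0 \<le> r * z ^ 4"
    using assms by (intro mult_nonneg_nonneg) auto
  ultimately show ?thesis
    by (simp add: power2_eq_square add_increasing add_increasing2)
next
  case False
  define s where "s = - ln r"
  have r: "r = exp (- s)" and s: "0 \<le> s"
    using assms False by (auto simp: s_def)
  show ?thesis
  proof (cases "s \<le> z\<^sup>2")
    case True
    have "s\<^sup>2 \<le> (z\<^sup>2)\<^sup>2"
      using True s by (intro power_mono) auto
    then have "r * (ln r)\<^sup>2 \<le> r * z ^ 4"
      using assms by (intro mult_left_mono) (auto simp: s_def power2_eq_square power4_eq_xxxx)
    then show ?thesis
      by (simp add: add_increasing2)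
  next
    case False
    \<comment> \<open>The factor s^2 is absorbed by half of the decay of \<open>exp (- s)\<close>;
      the other half lies below the Gaussian because s > z^2.\<close>
    have "s / 4 \<le> exp (s / 4)"
      using exp_ge_add_one_self[of "s / 4"] by linarith
    then have "s\<^sup>2 \<le> (4 * exp (s / 4))\<^sup>2"
      using s by (intro power_mono) auto
    also have "\<dots> = 16 * exp (s / 2)"
      by (simp add: power_mult_distrib exp_double[symmetric])
    finally have "exp (- s) * s\<^sup>2 \<le> exp (- s) * (16 * exp (s / 2))"
      by (intro mult_left_mono) auto
    also have "\<dots> = 16 * exp (- s / 2)"
      by (simp add: exp_add[symmetric])
    also have "\<dots> \<le> 16 * exp (- z\<^sup>2 / 2)"
      using False by simp
    finally have "r * (ln r)\<^sup>2 \<le> 16 * exp (- z\<^sup>2 / 2)"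
      by (simp add: r)
    moreover have "0 \<le> r * z ^ 4"
      using assms by (intro mult_nonneg_nonneg) auto
    ultimately show ?thesis
      by (simp add: add_increasing)
  qed
qed

lemma x_abs_ln_bound:
  fixes r z :: real
  assumes "0 < r"
  shows "r * \<bar>ln r\<bar> \<le> r * z\<^sup>2 + r\<^sup>2 + 2 * exp (- z\<^sup>2 / 2)"
proof (cases "1 \<le> r")
  case True
  have "ln r \<le> r"
    using ln_le_minus_one[OF assms] by linarith
  then have "r * \<bar>ln r\<bar> \<le> r * r"
    using assms True by (intro mult_left_mono) auto
  moreover have "0 \<le> r * z\<^sup>2"
    using assms by (intro mult_nonneg_nonneg) auto
  ultimately show ?thesis
    by (simp add: power2_eq_square add_increasing add_increasing2)
next
  case False
  define s where "s = - ln r"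
  have r: "r = exp (- s)" and s: "0 \<le> s"
    using assms False by (auto simp: s_def)
  show ?thesis
  proof (cases "s \<le> z\<^sup>2")
    case True
    then have "r * \<bar>ln r\<bar> \<le> r * z\<^sup>2"
      using assms s by (intro mult_left_mono) (auto simp: s_def)
    then show ?thesis
      by (simp add: add_increasing2)
  next
    case False
    have "s \<le> 2 * exp (s / 2)"
      using exp_ge_add_one_self[of "s / 2"] by linarith
    then have "exp (- s) * s \<le> exp (- s) * (2 * exp (s / 2))"
      by (intro mult_left_mono) auto
    also have "\<dots> = 2 * exp (- s / 2)"
      by (simp add: exp_add[symmetric])
    also have "\<dots> \<le> 2 * exp (- z\<^sup>2 / 2)"
      using False by simp
    finally have "r * \<bar>ln r\<bar> \<le> 2 * exp (- z\<^sup>2 / 2)"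
      using s by (simp add: r)
    moreover have "0 \<le> r * z\<^sup>2"
      using assms by (intro mult_nonneg_nonneg) auto
    ultimately show ?thesis
      by (simp add: add_increasing)
  qed
qed

section \<open>Cutoff functions\<close>

text \<open>Squaring removes the kink of the positive part: at 0 the difference quotient is at most
  |u|. This makes the cutoff differentiable on the whole space.\<close>

lemma has_real_derivative_positive_part_square:
  "((\<lambda>s::real. (max 0 s)\<^sup>2) has_real_derivative 2 * max 0 s) (at s)"
proof -
  consider "s < 0" | "s = 0" | "0 < s" by linarith
  then show ?thesis
  proof cases
    case 1
    have "((\<lambda>s::real. 0) has_real_derivative 2 * max 0 s) (at s)"
      using 1 by (auto intro!: derivative_eq_intros)
    then show ?thesis
      by (rule has_field_derivative_transform_within_open[where S="{..<0}"]) (use 1 in auto)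
  next
    case 2
    have "((\<lambda>u::real. (max 0 u)\<^sup>2 / u) \<longlongrightarrow> 0) (at 0)"
    proof (rule Lim_null_comparison)
      show "((\<lambda>u::real. \<bar>u\<bar>) \<longlongrightarrow> 0) (at 0)"
        by (auto intro!: tendsto_eq_intros)
      show "\<forall>\<^sub>F u::real in at 0. norm ((max 0 u)\<^sup>2 / u) \<le> \<bar>u\<bar>"
        by (intro always_eventually allI) (auto simp: max_def power2_eq_square)
    qed
    then show ?thesis
      using 2 by (simp add: has_field_derivative_iff)
  next
    case 3
    have "((\<lambda>s::real. s\<^sup>2) has_real_derivative 2 * max 0 s) (at s)"
      using 3 by (auto intro!: derivative_eq_intros)
    then show ?thesis
      by (rule has_field_derivative_transform_within_open[where S="{0<..}"]) (use 3 in auto)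
  qed
qed

text \<open>The radius is N = \<open>Suc n\<close>, hence never below 1. The outer square makes the
  function differentiable across the sphere of radius N and lets its gradient be controlled by its
  own square root.\<close>

definition cutoff :: "nat \<Rightarrow> 'a::euclidean_space \<Rightarrow> real" where
  "cutoff n x = (max 0 (1 - (norm x / real (Suc n))\<^sup>2))\<^sup>2"

definition cutoff_grad :: "nat \<Rightarrow> 'a::euclidean_space \<Rightarrow> 'a" where
  "cutoff_grad n x = (- 4 * max 0 (1 - (norm x / real (Suc n))\<^sup>2) / (real (Suc n))\<^sup>2) *\<^sub>R x"

lemma has_derivative_cutoff: "(cutoff n has_derivative (\<lambda>e. cutoff_grad n x \<bullet> e)) (at x)"
proof -
  \<comment> \<open>The inner product replaces the squared norm, since \<open>norm\<close> itself is
    not differentiable at the origin.\<close>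
  have "((\<lambda>x::'a. 1 - (x \<bullet> x) / (real (Suc n))\<^sup>2) has_derivative
      (\<lambda>e. - 2 * (x \<bullet> e) / (real (Suc n))\<^sup>2)) (at x)"
    by (auto intro!: derivative_eq_intros simp: inner_commute simp del: of_nat_Suc)
       (simp add: fun_eq_iff power2_eq_square power4_eq_xxxx field_simps del: of_nat_Suc)
  from has_derivative_compose[OF this
      has_real_derivative_positive_part_square[unfolded has_field_derivative_def]]
  have "((\<lambda>x::'a. (max 0 (1 - (x \<bullet> x) / (real (Suc n))\<^sup>2))\<^sup>2) has_derivative
      (\<lambda>e. 2 * max 0 (1 - (x \<bullet> x) / (real (Suc n))\<^sup>2) * (- 2 * (x \<bullet> e) / (real (Suc n))\<^sup>2))) (at x)" .
  then show ?thesis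
    by (simp add: cutoff_def[abs_def] cutoff_grad_def power_divide power2_norm_eq_inner
        del: of_nat_Suc) (simp add: mult_ac del: of_nat_Suc)
qed

lemma continuous_on_cutoff_grad: "continuous_on UNIV (cutoff_grad n)"
  unfolding cutoff_grad_def by (intro continuous_intros) (auto simp del: of_nat_Suc)

lemma cutoff_eq_0:
  assumes "real (Suc n) < norm x"
  shows "cutoff n x = 0" and "cutoff_grad n x = 0"
proof -
  have "1 < (norm x / real (Suc n))"
    using assms by (simp add: less_divide_eq del: of_nat_Suc)
  then have "max 0 (1 - (norm x / real (Suc n))\<^sup>2) = 0"
    using one_less_power[of "norm x / real (Suc n)" 2] by linarith
  then show "cutoff n x = 0" "cutoff_grad n x = 0"
    unfolding cutoff_def cutoff_grad_def by simp_all
qed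

lemma cutoff_nonneg: "0 \<le> cutoff n x"
  by (simp add: cutoff_def)

lemma cutoff_le_1: "cutoff n x \<le> 1"
  unfolding cutoff_def by (rule power_le_one) auto

text \<open>Differentiating the square leaves one factor of the positive part, which is the square
  root of the cutoff, and |x| \<le> N turns 4 |x| / N^2 into 4 / N.\<close>

lemma norm_cutoff_grad_le: "norm (cutoff_grad n x) \<le> sqrt (cutoff n x) * (4 / real (Suc n))"
proof (cases "norm x \<le> real (Suc n)")
  case True
  have "norm (cutoff_grad n x) =
      4 * max 0 (1 - (norm x / real (Suc n))\<^sup>2) / (real (Suc n))\<^sup>2 * norm x"
    by (simp add: cutoff_grad_def abs_mult del: of_nat_Suc)
  also have "\<dots> \<le> 4 * max 0 (1 - (norm x / real (Suc n))\<^sup>2) / (real (Suc n))\<^sup>2 * real (Suc n)"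
    using True by (intro mult_left_mono) auto
  also have "\<dots> = sqrt (cutoff n x) * (4 / real (Suc n))"
    by (simp add: cutoff_def power2_eq_square del: of_nat_Suc)
  finally show ?thesis .
qed (simp add: cutoff_eq_0)

lemma tendsto_cutoff: "(\<lambda>n. cutoff n x) \<longlonglongrightarrow> 1"
proof -
  have "(\<lambda>n. norm x / real (Suc n)) \<longlonglongrightarrow> 0"
    using LIMSEQ_Suc[OF lim_const_over_n[of "norm x"]] by simp
  then have "(\<lambda>n. (max 0 (1 - (norm x / real (Suc n))\<^sup>2))\<^sup>2) \<longlonglongrightarrow> (max 0 (1 - 0\<^sup>2))\<^sup>2"
    by (intro tendsto_intros)
  then show ?thesis
    by (simp add: cutoff_def)
qed

lemma tendsto_cutoff_grad: "(\<lambda>n. cutoff_grad n x) \<longlonglongrightarrow> 0"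
proof (rule Lim_null_comparison)
  show "\<forall>\<^sub>F n in sequentially. norm (cutoff_grad n x) \<le> 4 / real (Suc n)"
  proof (intro always_eventually allI)
    fix n
    have "sqrt (cutoff n x) * (4 / real (Suc n)) \<le> 1 * (4 / real (Suc n))"
      using cutoff_le_1 by (intro mult_right_mono) auto
    then show "norm (cutoff_grad n x) \<le> 4 / real (Suc n)"
      using norm_cutoff_grad_le[of n x] by linarith
  qed
  show "(\<lambda>n. 4 / real (Suc n)) \<longlonglongrightarrow> 0"
    using LIMSEQ_Suc[OF lim_const_over_n[of "4::real"]] by simp
qed

text \<open>Fatou's lemma: the cutoffs tend to 1 pointwise, and \<open>K\<close> bounds the
  truncated integrals for all \<open>n\<close> at once. Each truncated integrand is continuous with
  compact support, so its Bochner integral is a genuine one.\<close>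

lemma integrable_of_cutoff_bound:
  fixes u :: "'a::euclidean_space \<Rightarrow> real"
  assumes cont: "continuous_on UNIV u" and nonneg: "\<And>x. 0 \<le> u x"
    and bound: "\<And>n. (LINT x|lborel. cutoff n x * u x) \<le> K"
  shows "integrable lborel u"
proof -
  have [measurable]: "u \<in> borel_measurable borel"
    by (rule borel_measurable_continuous_onI[OF cont])
  have cutoff_cont: "continuous_on UNIV (cutoff n :: 'a \<Rightarrow> real)" for n
    by (meson has_derivative_cutoff has_derivative_continuous continuous_at_imp_continuous_on)
  have [measurable]: "(cutoff n :: 'a \<Rightarrow> real) \<in> borel_measurable borel" for n
    by (rule borel_measurable_continuous_onI[OF cutoff_cont])
  have nn: "(\<integral>\<^sup>+x. ennreal (cutoff n x * u x) \<partial>lborel) \<le> ennreal K" for n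
  proof -
    have "integrable lborel (\<lambda>x. cutoff n x * u x)"
      by (rule integrable_continuous_compact_support[where r="real (Suc n)"])
         (auto intro!: continuous_intros cont cutoff_cont simp: cutoff_eq_0 simp del: of_nat_Suc)
    then have "(\<integral>\<^sup>+x. ennreal (cutoff n x * u x) \<partial>lborel) = ennreal (LINT x|lborel. cutoff n x * u x)"
      by (intro nn_integral_eq_integral) (auto simp: nonneg cutoff_nonneg)
    then show ?thesis
      using bound by (simp add: ennreal_leI)
  qed
  have "liminf (\<lambda>n. ennreal (cutoff n x * u x)) = ennreal (u x)" for x
  proof (rule lim_imp_Liminf)
    have "(\<lambda>n. cutoff n x * u x) \<longlonglongrightarrow> 1 * u x"
      by (intro tendsto_intros tendsto_cutoff)
    then show "(\<lambda>n. ennreal (cutoff n x * u x)) \<longlonglongrightarrow> ennreal (u x)"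
      by (intro tendsto_ennrealI) simp
  qed simp
  then have "(\<integral>\<^sup>+x. ennreal (u x) \<partial>lborel) = (\<integral>\<^sup>+x. liminf (\<lambda>n. ennreal (cutoff n x * u x)) \<partial>lborel)"
    by simp
  also have "\<dots> \<le> liminf (\<lambda>n. \<integral>\<^sup>+x. ennreal (cutoff n x * u x) \<partial>lborel)"
    by (rule nn_integral_liminf) measurable
  also have "\<dots> \<le> liminf (\<lambda>n. ennreal K)"
    by (rule Liminf_mono) (simp add: nn)
  also have "\<dots> = ennreal K"
    by (simp add: Liminf_const)
  finally have "(\<integral>\<^sup>+x. ennreal (u x) \<partial>lborel) < \<infinity>"
    by (rule le_less_trans) simp
  then show ?thesis
    using nonneg by (intro integrableI_nonneg) auto
qed

section \<open>Integration by parts for an abstract flux\<close>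

text \<open>Here \<open>R\<close> is the divergence of the flux a r (w + b), whose derivative is
  \<open>J'\<close>. The hypothesis on \<open>G\<close> takes the place of decay at infinity: a
  single integrable function majorises r h^2 / N^2 on the ball of radius N for every N, and this
  controls the boundary terms created by the cutoffs.\<close>

lemma flux_dissipation:
  fixes r h G :: "'a::euclidean_space \<Rightarrow> real" and w :: "'a \<Rightarrow> 'a" and b :: 'a
    and J' :: "'a \<Rightarrow> 'a \<Rightarrow> 'a" and a :: real
  defines "R \<equiv> \<lambda>x. \<Sum>i\<in>Basis. J' x i \<bullet> i"
  assumes a: "0 < a"
    and r_pos: "\<And>x. 0 < r x" and r_cont: "continuous_on UNIV r"
    and r_int: "integrable lborel r" and r_one: "(LINT x|lborel. r x) = 1"
    and h_der: "\<And>x. (h has_derivative (\<lambda>e. w x \<bullet> e)) (at x)" and w_cont: "continuous_on UNIV w"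
    and J_der: "\<And>x. ((\<lambda>x. (a * r x) *\<^sub>R (w x + b)) has_derivative J' x) (at x)"
    and J'_cont: "\<And>i. i \<in> Basis \<Longrightarrow> continuous_on UNIV (\<lambda>x. J' x i)"
    and hR_int: "integrable lborel (\<lambda>x. h x * R x)"
    and G_int: "integrable lborel G"
    and G: "\<And>n x. norm x \<le> real (Suc n) \<Longrightarrow> r x * (h x / real (Suc n))\<^sup>2 \<le> G x"
  shows "integrable lborel (\<lambda>x. r x * (norm (w x))\<^sup>2)"
    and "(LINT x|lborel. h x * R x) \<le> - a * (LINT x|lborel. r x * (norm (w x))\<^sup>2)
           + a * norm b * sqrt (LINT x|lborel. r x * (norm (w x))\<^sup>2)"
proof -
  have h_cont: "continuous_on UNIV h"
    using h_der by (meson has_derivative_continuous continuous_at_imp_continuous_on)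
  have cutoff_cont: "continuous_on UNIV (cutoff n :: 'a \<Rightarrow> real)" for n
    by (meson has_derivative_cutoff has_derivative_continuous continuous_at_imp_continuous_on)
  have R_cont: "continuous_on UNIV R"
    unfolding R_def by (intro continuous_intros J'_cont)
  note conts = h_cont cutoff_cont R_cont r_cont w_cont J'_cont continuous_on_cutoff_grad
  \<comment> \<open>The divergence of cutoff times \<open>h\<close> times flux, expanded by the
    product rule. \<open>F n i\<close> is the i-th component of that field and \<open>F'\<close> its
    derivative; compact support makes the integral of \<open>D n\<close> vanish.\<close>
  define D where "D n x = cutoff n x * (h x * R x) + a * r x * h x * (cutoff_grad n x \<bullet> (w x + b))
      + a * (cutoff n x * r x * (w x \<bullet> (w x + b)))" for n x
  define F where "F n i x = cutoff n x * h x * (((a * r x) *\<^sub>R (w x + b)) \<bullet> i)" for n i x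
  define F' where "F' n i x e = cutoff n x * h x * (J' x e \<bullet> i)
      + (cutoff n x * (w x \<bullet> e) + (cutoff_grad n x \<bullet> e) * h x) * (((a * r x) *\<^sub>R (w x + b)) \<bullet> i)" for n i x e
  have F_der: "(F n i has_derivative F' n i x) (at x)" for n i x
    unfolding F_def[abs_def] F'_def[abs_def]
    by (rule has_derivative_mult has_derivative_inner_left has_derivative_cutoff h_der J_der)+
  have F'_cont: "continuous_on UNIV (\<lambda>x. F' n i x i)" if "i \<in> Basis" for n i
    unfolding F'_def by (intro continuous_intros conts that)
  have F'_int: "integrable lborel (\<lambda>x. F' n i x i)" if "i \<in> Basis" for n i
    by (rule integrable_continuous_compact_support[OF F'_cont[OF that], where r="real (Suc n)"])
       (simp add: F'_def cutoff_eq_0 del: of_nat_Suc)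
  have D_eq: "D n x = (\<Sum>i\<in>Basis. F' n i x i)" for n x
  proof -
    have "(\<Sum>i\<in>Basis. (w x \<bullet> i) * ((w x + b) \<bullet> i)) = w x \<bullet> (w x + b)"
      and "(\<Sum>i\<in>Basis. (cutoff_grad n x \<bullet> i) * ((w x + b) \<bullet> i)) = cutoff_grad n x \<bullet> (w x + b)"
      by (rule euclidean_inner[symmetric])+
    moreover have "F' n i x i = cutoff n x * h x * (J' x i \<bullet> i)
        + a * r x * h x * ((cutoff_grad n x \<bullet> i) * ((w x + b) \<bullet> i))
        + a * (cutoff n x * r x) * ((w x \<bullet> i) * ((w x + b) \<bullet> i))" for i
      unfolding F'_def by (simp add: ring_distribs mult_ac)
    ultimately show ?thesis
      unfolding D_def R_def
      by (simp only: sum.distrib sum_distrib_left[symmetric])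
  qed
  have D_int: "integrable lborel (D n)" and D_0: "(LINT x|lborel. D n x) = 0" for n
  proof -
    show "integrable lborel (D n)"
      unfolding D_eq[abs_def] by (intro Bochner_Integration.integrable_sum F'_int)
    have "(LINT x|lborel. F' n i x i) = 0" if "i \<in> Basis" for i
      by (rule integral_directional_derivative_eq_0[OF F_der F'_cont[OF that], where r="real (Suc n)"])
         (simp add: F_def cutoff_eq_0 del: of_nat_Suc)
    then show "(LINT x|lborel. D n x) = 0"
      unfolding D_eq by (simp add: F'_int)
  qed
  have G_nonneg: "0 \<le> G x" for x
  proof -
    obtain n where "norm x \<le> real n"
      using real_arch_simple by blast
    then have "norm x \<le> real (Suc n)"
      by simp
    then have "r x * (h x / real (Suc n))\<^sup>2 \<le> G x"
      by (rule G)
    moreover have "0 \<le> r x * (h x / real (Suc n))\<^sup>2"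
      using less_imp_le[OF r_pos] by simp
    ultimately show ?thesis by linarith
  qed

  \<comment> \<open>Uniform bound on the truncated Fisher information\<close>
  \<comment> \<open>The weight 1/4 is chosen because the dissipation has to absorb two such terms:
    half of it survives, which explains the factor \<open>2 / a\<close> below.\<close>
  have young: "p * q \<le> p\<^sup>2 / 4 + q\<^sup>2" for p q :: real
    using zero_le_power2[of "p / 2 - q"] by (simp add: power2_diff power_divide)
  \<comment> \<open>Bound for the boundary term, applied with \<open>v\<close> equal to
    \<open>w x\<close>, to \<open>b\<close> and to their sum. The 16 is the square of the 4 in the
    gradient bound for the cutoff.\<close>
  have cross: "r x * \<bar>h x * (cutoff_grad n x \<bullet> v)\<bar> \<le> r x * (cutoff n x * (norm v)\<^sup>2 / 4) + 16 * G x" for n x v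
  proof (cases "norm x \<le> real (Suc n)")
    case True
    have "\<bar>h x * (cutoff_grad n x \<bullet> v)\<bar> \<le> \<bar>h x\<bar> * (norm (cutoff_grad n x) * norm v)"
      by (simp add: abs_mult mult_left_mono Cauchy_Schwarz_ineq2)
    also have "\<dots> \<le> \<bar>h x\<bar> * (sqrt (cutoff n x) * (4 / real (Suc n)) * norm v)"
      by (intro mult_left_mono mult_right_mono norm_cutoff_grad_le) auto
    also have "\<dots> = (sqrt (cutoff n x) * norm v) * (4 * (\<bar>h x\<bar> / real (Suc n)))"
      by simp
    also have "\<dots> \<le> (sqrt (cutoff n x) * norm v)\<^sup>2 / 4 + (4 * (\<bar>h x\<bar> / real (Suc n)))\<^sup>2"
      by (rule young)
    also have "\<dots> = cutoff n x * (norm v)\<^sup>2 / 4 + 16 * (h x / real (Suc n))\<^sup>2"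
      by (simp add: power_mult_distrib power_divide cutoff_nonneg)
    finally have "r x * \<bar>h x * (cutoff_grad n x \<bullet> v)\<bar>
        \<le> r x * (cutoff n x * (norm v)\<^sup>2 / 4 + 16 * (h x / real (Suc n))\<^sup>2)"
      by (intro mult_left_mono less_imp_le[OF r_pos])
    then show ?thesis
      using G[OF True] by (simp add: ring_distribs)
  next
    case False
    then show ?thesis
      using G_nonneg[of x] by (simp add: cutoff_eq_0 del: of_nat_Suc)
  qed
  \<comment> \<open>Twice the collected errors: 64 = 2 (16 + 16) from two boundary terms, and 3
    rounds up 2 (1 + 1/4) from the terms with |b|^2.\<close>
  define K where "K x = 2 / a * \<bar>h x * R x\<bar> + 64 * G x + 3 * (r x * (norm b)\<^sup>2)" for x
  have K_int: "integrable lborel K"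
    unfolding K_def by (intro Bochner_Integration.integrable_add integrable_mult_right
        integrable_mult_left integrable_abs hR_int G_int r_int)
  \<comment> \<open>As \<open>D n\<close> has integral 0, integrating this inequality bounds the
    truncated Fisher information independently of \<open>n\<close>.\<close>
  have pointwise: "cutoff n x * (r x * (norm (w x))\<^sup>2) \<le> 2 / a * D n x + K x" for n x
  proof -
    define s where "s = cutoff n x * r x"
    have s: "0 \<le> s" "s \<le> r x"
      using less_imp_le[OF r_pos[of x]] cutoff_nonneg[of n x] cutoff_le_1[of n x]
      by (auto simp: s_def mult_left_le_one_le)
    have "\<bar>w x \<bullet> b\<bar> \<le> norm (w x) * norm b"
      by (rule Cauchy_Schwarz_ineq2)
    also have "\<dots> \<le> (norm (w x))\<^sup>2 / 4 + (norm b)\<^sup>2"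
      by (rule young)
    finally have "s * - (w x \<bullet> b) \<le> s * ((norm (w x))\<^sup>2 / 4 + (norm b)\<^sup>2)"
      using s by (intro mult_left_mono) auto
    also have "\<dots> \<le> s * (norm (w x))\<^sup>2 / 4 + r x * (norm b)\<^sup>2"
      using s mult_right_mono[OF s(2), of "(norm b)\<^sup>2"] by (simp add: ring_distribs)
    finally have 1: "- (s * (w x \<bullet> b)) \<le> s * (norm (w x))\<^sup>2 / 4 + r x * (norm b)\<^sup>2"
      by simp
    have 2: "r x * \<bar>h x * (cutoff_grad n x \<bullet> w x)\<bar> \<le> s * (norm (w x))\<^sup>2 / 4 + 16 * G x"
      using cross[of x n "w x"] by (simp add: s_def mult_ac)
    have "r x * \<bar>h x * (cutoff_grad n x \<bullet> b)\<bar> \<le> s * (norm b)\<^sup>2 / 4 + 16 * G x"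
      using cross[of x n b] by (simp add: s_def mult_ac)
    then have 3: "r x * \<bar>h x * (cutoff_grad n x \<bullet> b)\<bar> \<le> r x * (norm b)\<^sup>2 / 4 + 16 * G x"
      using mult_right_mono[OF s(2), of "(norm b)\<^sup>2"] by simp
    have 4: "- (cutoff n x * (h x * R x)) \<le> \<bar>h x * R x\<bar>"
    proof -
      have "\<bar>cutoff n x * (h x * R x)\<bar> \<le> 1 * \<bar>h x * R x\<bar>"
        unfolding abs_mult[of "cutoff n x"]
        using cutoff_nonneg[of n x] cutoff_le_1[of n x] by (intro mult_right_mono) auto
      then show ?thesis by linarith
    qed
    have "r x * (h x * (cutoff_grad n x \<bullet> (w x + b)))
        = r x * (h x * (cutoff_grad n x \<bullet> w x)) + r x * (h x * (cutoff_grad n x \<bullet> b))"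
      by (simp add: inner_add_right ring_distribs)
    moreover have "\<bar>r x * (h x * (cutoff_grad n x \<bullet> u))\<bar> = r x * \<bar>h x * (cutoff_grad n x \<bullet> u)\<bar>" for u
      using r_pos[of x] by (simp add: abs_mult)
    ultimately have 5: "- (r x * (h x * (cutoff_grad n x \<bullet> (w x + b))))
        \<le> s * (norm (w x))\<^sup>2 / 4 + r x * (norm b)\<^sup>2 / 4 + 32 * G x"
      using 2 3 by (smt (verit))
    have "D n x = cutoff n x * (h x * R x) + a * (r x * (h x * (cutoff_grad n x \<bullet> (w x + b)))
        + s * (w x \<bullet> b) + s * (norm (w x))\<^sup>2)"
      by (simp add: D_def s_def ring_distribs inner_add_right power2_norm_eq_inner mult_ac)
    moreover define E where "E = r x * (h x * (cutoff_grad n x \<bullet> (w x + b)))"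
    ultimately have "2 / a * D n x = 2 / a * (cutoff n x * (h x * R x))
        + 2 * (E + s * (w x \<bullet> b) + s * (norm (w x))\<^sup>2)"
      using a by (simp add: field_simps)
    moreover have "- (2 / a * (cutoff n x * (h x * R x))) \<le> 2 / a * \<bar>h x * R x\<bar>"
      using mult_left_mono[OF 4, of "2 / a"] a by simp
    ultimately have "2 * (E + s * (w x \<bullet> b) + s * (norm (w x))\<^sup>2) \<le> 2 / a * D n x + 2 / a * \<bar>h x * R x\<bar>"
      by (simp only:)
    moreover have "0 \<le> r x * (norm b)\<^sup>2"
      using less_imp_le[OF r_pos] by simp
    \<comment> \<open>The linear skeleton of the estimate, with P the truncated dissipation, Q = r
      |b|^2, C the boundary term \<open>E\<close> and W the cross term with
      \<open>b\<close>.\<close>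
    moreover have "P \<le> A + (B + 64 * g + 3 * Q)"
      if "2 * (C + W + P) \<le> A + B" "0 \<le> Q" "- W \<le> P / 4 + Q" "- C \<le> P / 4 + Q / 4 + 32 * g"
      for A B C g P Q W :: real
      using that by (simp add: field_simps)
    ultimately have "s * (norm (w x))\<^sup>2 \<le> 2 / a * D n x + K x"
      unfolding K_def using 1 5[folded E_def] by blast
    then show ?thesis
      by (simp add: s_def)
  qed
  show w_int: "integrable lborel (\<lambda>x. r x * (norm (w x))\<^sup>2)"
  proof (rule integrable_of_cutoff_bound)
    show "continuous_on UNIV (\<lambda>x. r x * (norm (w x))\<^sup>2)"
      by (intro continuous_intros conts)
    show "0 \<le> r x * (norm (w x))\<^sup>2" for x
      using less_imp_le[OF r_pos] by simp
    show "(LINT x|lborel. cutoff n x * (r x * (norm (w x))\<^sup>2)) \<le> (LINT x|lborel. K x)" for n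
    proof -
      have "integrable lborel (\<lambda>x. cutoff n x * (r x * (norm (w x))\<^sup>2))"
        by (rule integrable_continuous_compact_support[where r="real (Suc n)"],
            intro continuous_intros conts) (simp add: cutoff_eq_0 del: of_nat_Suc)
      then have "(LINT x|lborel. cutoff n x * (r x * (norm (w x))\<^sup>2)) \<le> (LINT x|lborel. 2 / a * D n x + K x)"
        by (rule integral_mono)
           (intro Bochner_Integration.integrable_add integrable_mult_right D_int K_int pointwise)+
      also have "\<dots> = (LINT x|lborel. K x)"
        by (subst Bochner_Integration.integral_add[OF integrable_mult_right[OF D_int] K_int])
           (simp add: D_0)
      finally show ?thesis .
    qed
  qed

  \<comment> \<open>Removal of the cutoff\<close>
  define I where "I = (LINT x|lborel. r x * (norm (w x))\<^sup>2)"
  have I_nonneg: "0 \<le> I"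
    unfolding I_def using less_imp_le[OF r_pos] by (intro Bochner_Integration.integral_nonneg) simp
  have [measurable]: "r \<in> borel_measurable borel" "w \<in> borel_measurable borel"
    by (rule borel_measurable_continuous_onI, rule r_cont w_cont)+
  \<comment> \<open>The parameter has two uses: c = 1 gives integrability of the cross term, and
    optimising over c recovers the Cauchy-Schwarz inequality for integrals.\<close>
  have inner_bound: "\<bar>w x \<bullet> b\<bar> \<le> (norm (w x))\<^sup>2 / (2 * c) + c / 2 * (norm b)\<^sup>2" if "0 < c" for c x
  proof -
    have "\<bar>w x \<bullet> b\<bar> \<le> norm (w x) * norm b"
      by (rule Cauchy_Schwarz_ineq2)
    also have "\<dots> \<le> (norm (w x))\<^sup>2 / (2 * c) + c / 2 * (norm b)\<^sup>2"
      using zero_le_power2[of "norm (w x) - c * norm b"] that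
      by (simp add: field_simps power2_eq_square)
    finally show ?thesis .
  qed
  have wb_int: "integrable lborel (\<lambda>x. r x * (w x \<bullet> b))"
  proof (rule Bochner_Integration.integrable_bound)
    show "integrable lborel (\<lambda>x. r x * (norm (w x))\<^sup>2 + (norm b)\<^sup>2 * r x)"
      by (intro Bochner_Integration.integrable_add w_int integrable_mult_right r_int)
    show "AE x in lborel. norm (r x * (w x \<bullet> b)) \<le> norm (r x * (norm (w x))\<^sup>2 + (norm b)\<^sup>2 * r x)"
    proof (intro AE_I2)
      fix x :: 'a
      have "\<bar>w x \<bullet> b\<bar> \<le> (norm (w x))\<^sup>2 + (norm b)\<^sup>2"
        using inner_bound[of 1 x] zero_le_power2[of "norm (w x)"] zero_le_power2[of "norm b"] by linarith
      from mult_left_mono[OF this less_imp_le[OF r_pos[of x]]]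
      show "norm (r x * (w x \<bullet> b)) \<le> norm (r x * (norm (w x))\<^sup>2 + (norm b)\<^sup>2 * r x)"
        using r_pos[of x] by (simp add: abs_mult ring_distribs mult.commute)
    qed
  qed measurable
  have "(\<lambda>n. LINT x|lborel. D n x)
      \<longlonglongrightarrow> (LINT x|lborel. h x * R x + a * (r x * (norm (w x))\<^sup>2 + r x * (w x \<bullet> b)))"
  proof (rule integral_dominated_convergence)
    \<comment> \<open>This majorant is integrable because \<open>w_int\<close> is already available;
      its middle group bounds the boundary term through \<open>cross\<close> with v = w + b. The
      boundary term itself tends to 0 pointwise with the gradient of the cutoff.\<close>
    let ?B = "\<lambda>x. \<bar>h x * R x\<bar> + a * (r x * (norm (w x))\<^sup>2 + (norm b)\<^sup>2 * r x + 16 * G x)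
        + a * \<bar>r x * (norm (w x))\<^sup>2 + r x * (w x \<bullet> b)\<bar>"
    show "integrable lborel ?B"
      by (intro Bochner_Integration.integrable_add w_int integrable_mult_right r_int integrable_abs
          hR_int G_int wb_int)
    show "AE x in lborel. norm (D n x) \<le> ?B x" for n
    proof (intro AE_I2)
      fix x :: 'a
      have c: "\<bar>cutoff n x * y\<bar> \<le> \<bar>y\<bar>" for y
        unfolding abs_mult using cutoff_nonneg[of n x] cutoff_le_1[of n x]
        by (intro mult_left_le_one_le) auto
      have "(norm (w x + b))\<^sup>2 \<le> (norm (w x) + norm b)\<^sup>2"
        by (intro power_mono norm_triangle_ineq) auto
      also have "\<dots> \<le> 2 * (norm (w x))\<^sup>2 + 2 * (norm b)\<^sup>2"
        using zero_le_power2[of "norm (w x) - norm b"] by (simp add: power2_sum power2_diff)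
      finally have "cutoff n x * (norm (w x + b))\<^sup>2 \<le> 2 * (norm (w x))\<^sup>2 + 2 * (norm b)\<^sup>2"
        using mult_left_le_one_le[OF zero_le_power2[of "norm (w x + b)"] cutoff_nonneg[of n x] cutoff_le_1[of n x]]
        by (rule order_trans[rotated])
      moreover have "0 \<le> (norm (w x))\<^sup>2" "0 \<le> (norm b)\<^sup>2"
        by simp_all
      ultimately have "cutoff n x * (norm (w x + b))\<^sup>2 / 4 \<le> (norm (w x))\<^sup>2 + (norm b)\<^sup>2"
        by linarith
      from mult_left_mono[OF this less_imp_le[OF r_pos[of x]]] cross[of x n "w x + b"]
      have "r x * \<bar>h x * (cutoff_grad n x \<bullet> (w x + b))\<bar> \<le> r x * (norm (w x))\<^sup>2 + (norm b)\<^sup>2 * r x + 16 * G x"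
        by (simp add: ring_distribs mult.commute)
      from mult_left_mono[OF this less_imp_le[OF a]]
      have 1: "\<bar>a * r x * h x * (cutoff_grad n x \<bullet> (w x + b))\<bar>
          \<le> a * (r x * (norm (w x))\<^sup>2 + (norm b)\<^sup>2 * r x + 16 * G x)"
        using r_pos[of x] a by (simp add: abs_mult mult.assoc)
      have "cutoff n x * r x * (w x \<bullet> (w x + b)) = cutoff n x * (r x * (norm (w x))\<^sup>2 + r x * (w x \<bullet> b))"
        by (simp add: inner_add_right power2_norm_eq_inner ring_distribs)
      then have 2: "\<bar>a * (cutoff n x * r x * (w x \<bullet> (w x + b)))\<bar> \<le> a * \<bar>r x * (norm (w x))\<^sup>2 + r x * (w x \<bullet> b)\<bar>"
        using c[of "r x * (norm (w x))\<^sup>2 + r x * (w x \<bullet> b)"] a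
        by (simp only: abs_mult[of a]) simp
      show "norm (D n x) \<le> ?B x"
        using 1 2 c[of "h x * R x"] unfolding D_def real_norm_def by linarith
    qed
    show "AE x in lborel. (\<lambda>n. D n x) \<longlonglongrightarrow> h x * R x + a * (r x * (norm (w x))\<^sup>2 + r x * (w x \<bullet> b))"
    proof (intro AE_I2)
      fix x :: 'a
      have "(\<lambda>n. D n x) \<longlonglongrightarrow> 1 * (h x * R x) + a * r x * h x * (0 \<bullet> (w x + b))
          + a * (1 * r x * (w x \<bullet> (w x + b)))"
        unfolding D_def by (intro tendsto_intros tendsto_cutoff tendsto_cutoff_grad)
      then show "(\<lambda>n. D n x) \<longlonglongrightarrow> h x * R x + a * (r x * (norm (w x))\<^sup>2 + r x * (w x \<bullet> b))"
        by (simp add: inner_add_right power2_norm_eq_inner ring_distribs)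
    qed
    show "(\<lambda>x. h x * R x + a * (r x * (norm (w x))\<^sup>2 + r x * (w x \<bullet> b))) \<in> borel_measurable lborel"
      by (intro borel_measurable_integrable Bochner_Integration.integrable_add integrable_mult_right
          hR_int w_int wb_int)
    show "D n \<in> borel_measurable lborel" for n
      by (rule borel_measurable_integrable[OF D_int])
  qed
  then have "(LINT x|lborel. h x * R x + a * (r x * (norm (w x))\<^sup>2 + r x * (w x \<bullet> b))) = 0"
    by (simp only: D_0 LIMSEQ_const_iff)
  then have main: "(LINT x|lborel. h x * R x) = - a * I - a * (LINT x|lborel. r x * (w x \<bullet> b))"
    using hR_int w_int wb_int by (simp add: I_def ring_distribs)

  \<comment> \<open>Cauchy-Schwarz bound for the cross term\<close>
  have wb_bound: "- (LINT x|lborel. r x * (w x \<bullet> b)) \<le> I / (2 * c) + c / 2 * (norm b)\<^sup>2" if c: "0 < c" for c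
  proof -
    have "- (LINT x|lborel. r x * (w x \<bullet> b)) = (LINT x|lborel. - (r x * (w x \<bullet> b)))"
      by simp
    also have "\<dots> \<le> (LINT x|lborel. (r x * (norm (w x))\<^sup>2) / (2 * c) + c / 2 * (norm b)\<^sup>2 * r x)"
    proof (rule integral_mono)
      fix x :: 'a
      have "r x * - (w x \<bullet> b) \<le> r x * ((norm (w x))\<^sup>2 / (2 * c) + c / 2 * (norm b)\<^sup>2)"
        using inner_bound[OF c, of x] less_imp_le[OF r_pos[of x]] by (intro mult_left_mono) auto
      then show "- (r x * (w x \<bullet> b)) \<le> (r x * (norm (w x))\<^sup>2) / (2 * c) + c / 2 * (norm b)\<^sup>2 * r x"
        by (simp add: ring_distribs mult_ac)
    qed (use w_int wb_int r_int in auto)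
    also have "\<dots> = I / (2 * c) + c / 2 * (norm b)\<^sup>2"
      using w_int r_int by (simp add: I_def r_one)
    finally show ?thesis .
  qed
  \<comment> \<open>The optimal parameter is c = sqrt I / |b|. For I = 0 and nonzero b it
    degenerates to 0, which can only be approached; this is the reason for the slack
    \<open>e\<close>.\<close>
  have "- (LINT x|lborel. r x * (w x \<bullet> b)) \<le> norm b * sqrt I"
  proof (rule field_le_epsilon)
    fix e :: real assume e: "0 < e"
    show "- (LINT x|lborel. r x * (w x \<bullet> b)) \<le> norm b * sqrt I + e"
    proof (cases "I = 0 \<or> b = 0")
      case True
      then consider "I = 0" | "b = 0" by blast
      then show ?thesis
      proof cases
        case 1
        define q where "q = (norm b)\<^sup>2 + 1"
        have q: "0 < q" "(norm b)\<^sup>2 \<le> q"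
          by (auto simp: q_def add_nonneg_pos)
        have "- (LINT x|lborel. r x * (w x \<bullet> b)) \<le> e / q / 2 * (norm b)\<^sup>2"
          using wb_bound[of "e / q"] 1 e q by simp
        also have "\<dots> \<le> e / q / 2 * q"
          using e q by (intro mult_left_mono) auto
        also have "\<dots> \<le> e"
          using e q by simp
        finally show ?thesis
          using 1 by simp
      next
        case 2
        then show ?thesis using e by simp
      qed
    next
      case False
      then have "0 < sqrt I / norm b"
        using I_nonneg by simp
      from wb_bound[OF this]
      have "- (LINT x|lborel. r x * (w x \<bullet> b)) \<le> I / (2 * (sqrt I / norm b)) + sqrt I / norm b / 2 * (norm b)\<^sup>2" .
      also have "\<dots> = norm b * sqrt I"
      proof -
        define q where "q = sqrt I"
        have q: "I = q * q" "q \<noteq> 0"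
          using I_nonneg False by (simp_all add: q_def)
        have "q * q / (2 * (q / norm b)) + q / norm b / 2 * (norm b)\<^sup>2 = norm b * q"
          using q(2) False by (simp add: power2_eq_square)
        then show ?thesis
          unfolding q_def[symmetric] by (simp only: q(1)[symmetric])
      qed
      finally show ?thesis using e by simp
    qed
  qed
  then have "a * - (LINT x|lborel. r x * (w x \<bullet> b)) \<le> a * (norm b * sqrt I)"
    using a by (intro mult_left_mono) auto
  then have "(LINT x|lborel. h x * R x) \<le> - a * I + a * norm b * sqrt I"
    unfolding main by linarith
  then show "(LINT x|lborel. h x * R x) \<le> - a * (LINT x|lborel. r x * (norm (w x))\<^sup>2)
           + a * norm b * sqrt (LINT x|lborel. r x * (norm (w x))\<^sup>2)"
    unfolding I_def .
qed

section \<open>Gradients, the Gaussian logarithm and integrable majorants\<close>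

lemma gradient_eqI:
  assumes "(g has_derivative (\<lambda>e. u \<bullet> e)) (at x)"
  shows "gradient g x = u"
  using frechet_derivative_at[OF assms, symmetric]
  by (simp add: gradient_def euclidean_representation)

lemma has_derivative_gradient:
  fixes g :: "'a::euclidean_space \<Rightarrow> real"
  assumes "g differentiable (at x)"
  shows "(g has_derivative (\<lambda>e. gradient g x \<bullet> e)) (at x)"
proof -
  let ?D = "frechet_derivative g (at x)"
  have D: "(g has_derivative ?D) (at x)"
    using assms frechet_derivative_works by blast
  have "linear (\<lambda>e. gradient g x \<bullet> e)"
    by (rule bounded_linear.linear[OF bounded_linear_inner_right])
  then have "?D = (\<lambda>e. gradient g x \<bullet> e)"
    by (rule linear_eq_stdbasis[OF has_derivative_linear[OF D]]) (simp add: gradient_def)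
  then show ?thesis
    using D by (simp only:)
qed

lemma gaussian_density_pos: "0 < v \<Longrightarrow> 0 < gaussian_density m v x"
  by (simp add: gaussian_density_def)

lemma ln_div_gaussian_density:
  fixes m :: "'a::euclidean_space"
  assumes "0 < v" "0 < r"
  shows "ln (r / gaussian_density m v x)
    = ln r + (norm (x - m))\<^sup>2 / (2 * v) - ln ((2 * pi * v) powr (- real DIM('a) / 2))"
  using assms by (simp add: gaussian_density_def ln_div ln_mult)

lemma norm_diff_square_le:
  fixes x m :: "'a::real_normed_vector"
  shows "(norm (x - m))\<^sup>2 \<le> 2 * (norm x)\<^sup>2 + 2 * (norm m)\<^sup>2"
proof -
  have "(norm (x - m))\<^sup>2 \<le> (norm x + norm m)\<^sup>2"
    by (intro power_mono norm_triangle_ineq4) auto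
  also have "\<dots> \<le> 2 * (norm x)\<^sup>2 + 2 * (norm m)\<^sup>2"
    using zero_le_power2[of "norm x - norm m"] by (simp add: power2_sum power2_diff)
  finally show ?thesis .
qed

lemma prob_density_integral:
  fixes r :: "'a::euclidean_space \<Rightarrow> real"
  assumes "prob_space (measure_of_density r)" and [measurable]: "r \<in> borel_measurable borel"
    and nonneg: "\<And>x. 0 \<le> r x"
  shows "integrable lborel r" and "(LINT x|lborel. r x) = 1"
proof -
  have nn: "(\<integral>\<^sup>+x. ennreal (r x) \<partial>lborel) = 1"
    using prob_space.emeasure_space_1[OF assms(1)] by (simp add: emeasure_density)
  then show int: "integrable lborel r"
    using nonneg by (intro integrableI_nonneg) auto
  show "(LINT x|lborel. r x) = 1"
    using nn_integral_eq_integral[OF int] nn nonneg by simp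
qed

text \<open>The consensus point depends on the density as a whole but not on the space variable, so
  the drift is the product of \<open>r\<close> with an affine field. Writing everything as one trace
  gives the form of \<open>R\<close> in \<open>flux_dissipation\<close>.\<close>

lemma fokker_planck_rhs_eq:
  fixes r :: "'a::euclidean_space \<Rightarrow> real"
  assumes "r differentiable (at x)"
  shows "fokker_planck_rhs f \<alpha> lam \<delta> r x = (\<Sum>i\<in>Basis.
    (lam *\<^sub>R ((gradient r x \<bullet> i) *\<^sub>R (x - consensus_point f \<alpha> (measure_of_density r)) + r x *\<^sub>R i)
     + (\<delta>\<^sup>2 / 2) *\<^sub>R frechet_derivative (gradient r) (at x) i) \<bullet> i)"
proof -
  let ?m = "consensus_point f \<alpha> (measure_of_density r)"
  have "((\<lambda>y. r y *\<^sub>R (y - ?m)) has_derivative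
      (\<lambda>e. r x *\<^sub>R e + (gradient r x \<bullet> e) *\<^sub>R (x - ?m))) (at x)"
    by (rule has_derivative_scaleR[OF has_derivative_gradient[OF assms]])
       (auto intro!: derivative_eq_intros)
  from frechet_derivative_at[OF this, symmetric] show ?thesis
    unfolding fokker_planck_rhs_def divergence_def laplacian_def
    by (simp add: inner_add_left sum.distrib sum_distrib_left ring_distribs)
qed

text \<open>Supplies the majorant \<open>G\<close> of \<open>flux_dissipation\<close>. The only
  terms beyond second moments are multiples of r |x|^4, and dividing by N^2 reduces them to r |x|^2
  on the ball; all other terms only decrease since N \<ge> 1. The right-hand side is free of
  N.\<close>

lemma ln_div_gaussian_square_bound:
  fixes x m :: "'a::euclidean_space"
  assumes v: "0 < v" and r: "0 < r" and N: "1 \<le> N" "norm x \<le> N"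
    and c: "c = ln ((2 * pi * v) powr (- real DIM('a) / 2))"
  shows "r * (ln (r / gaussian_density m v x) / N)\<^sup>2
    \<le> (3 + 6 / v\<^sup>2) * ((norm x)\<^sup>2 * r)
       + (12 * r\<^sup>2 + 48 * exp (- (norm x)\<^sup>2 / 2) + (6 / v\<^sup>2 * (norm m) ^ 4 + 3 * c\<^sup>2) * r)"
    (is "_ \<le> ?A * ((norm x)\<^sup>2 * r) + ?S")
proof -
  define h where "h = ln (r / gaussian_density m v x)"
  define q where "q = (norm (x - m))\<^sup>2 / (2 * v)"
  have h: "h = ln r + q - c"
    unfolding h_def q_def c by (rule ln_div_gaussian_density[OF v r])
  have "h\<^sup>2 \<le> 3 * (ln r)\<^sup>2 + 3 * q\<^sup>2 + 3 * c\<^sup>2"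
    using zero_le_power2[of "ln r - q"] zero_le_power2[of "ln r + c"] zero_le_power2[of "q + c"]
    unfolding h by (simp add: power2_eq_square algebra_simps)
  moreover have "q\<^sup>2 \<le> 2 / v\<^sup>2 * norm x ^ 4 + 2 / v\<^sup>2 * norm m ^ 4"
  proof -
    have "((norm (x - m))\<^sup>2)\<^sup>2 \<le> (2 * (norm x)\<^sup>2 + 2 * (norm m)\<^sup>2)\<^sup>2"
      by (intro power_mono norm_diff_square_le) auto
    also have "\<dots> \<le> 8 * norm x ^ 4 + 8 * norm m ^ 4"
      using zero_le_power2[of "(norm x)\<^sup>2 - (norm m)\<^sup>2"]
      by (simp add: power2_eq_square power4_eq_xxxx algebra_simps)
    finally show ?thesis
      using v unfolding q_def by (simp add: power_divide power_mult_distrib field_simps)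
  qed
  ultimately have "h\<^sup>2 \<le> 3 * (ln r)\<^sup>2 + 6 / v\<^sup>2 * norm x ^ 4 + (6 / v\<^sup>2 * norm m ^ 4 + 3 * c\<^sup>2)"
    by simp
  from mult_left_mono[OF this less_imp_le[OF r]]
  have "r * h\<^sup>2 \<le> 3 * (r * (ln r)\<^sup>2) + 6 / v\<^sup>2 * (r * norm x ^ 4) + (6 / v\<^sup>2 * norm m ^ 4 + 3 * c\<^sup>2) * r"
    by (simp add: algebra_simps)
  \<comment> \<open>The logarithmic bound is used with z = |x|: three times its coefficients 1, 4
    and 16 give the 3 in \<open>?A\<close>, the 12 and the 48.\<close>
  also have "\<dots> \<le> ?A * (r * norm x ^ 4) + ?S"
    using x_ln_square_bound[OF r, of "norm x"] by (simp add: algebra_simps)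
  finally have "r * h\<^sup>2 / N\<^sup>2 \<le> (?A * (r * norm x ^ 4) + ?S) / N\<^sup>2"
    by (rule divide_right_mono) simp
  also have "\<dots> = ?A * (r * norm x ^ 4 / N\<^sup>2) + ?S / N\<^sup>2"
    by (simp add: add_divide_distrib)
  also have "\<dots> \<le> ?A * ((norm x)\<^sup>2 * r) + ?S"
  proof (intro add_mono mult_left_mono)
    have "(norm x)\<^sup>2 * (norm x)\<^sup>2 \<le> (norm x)\<^sup>2 * N\<^sup>2"
      using N by (intro mult_left_mono power_mono) auto
    from mult_left_mono[OF this less_imp_le[OF r]]
    show "r * norm x ^ 4 / N\<^sup>2 \<le> (norm x)\<^sup>2 * r"
      using N by (simp add: divide_le_eq power2_eq_square power4_eq_xxxx mult_ac)
    have "0 \<le> ?S"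
      using r by (intro add_nonneg_nonneg mult_nonneg_nonneg) auto
    moreover have "1 \<le> N\<^sup>2"
      using N by simp
    ultimately show "?S / N\<^sup>2 \<le> ?S"
      by (simp add: divide_le_eq mult_left_le) (metis mult_le_cancel_left1 not_le)
  qed simp
  finally show ?thesis
    unfolding h_def[symmetric] by (simp add: power_divide)
qed

text \<open>The logarithm of the Gaussian is quadratic and is paid for by the second moment. For r
  |ln r|, large values are controlled by the square of the density, small ones by the second moment
  and a fixed Gaussian.\<close>

lemma integrable_ln_div_gaussian:
  fixes r :: "'a::euclidean_space \<Rightarrow> real"
  assumes v: "0 < v" and r_pos: "\<And>x. 0 < r x" and [measurable]: "r \<in> borel_measurable borel"
    and r_int: "integrable lborel r"
    and r_mom: "integrable lborel (\<lambda>x. (norm x)\<^sup>2 * r x)"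
    and r_sq: "integrable lborel (\<lambda>x. (r x)\<^sup>2)"
  shows "integrable lborel (\<lambda>x. ln (r x / gaussian_density m v x) * r x)"
proof (rule Bochner_Integration.integrable_bound)
  define c where "c = ln ((2 * pi * v) powr (- real DIM('a) / 2))"
  let ?B = "\<lambda>x. (1 + 1 / v) * ((norm x)\<^sup>2 * r x) + (r x)\<^sup>2 + 2 * exp (- (norm x)\<^sup>2 / 2)
      + ((norm m)\<^sup>2 / v + \<bar>c\<bar>) * r x"
  show "integrable lborel ?B"
    by (intro Bochner_Integration.integrable_add integrable_mult_right r_int r_mom r_sq
        integrable_exp_neg_norm_square)
  show "(\<lambda>x. ln (r x / gaussian_density m v x) * r x) \<in> borel_measurable lborel"
    unfolding gaussian_density_def by measurable
  show "AE x in lborel. norm (ln (r x / gaussian_density m v x) * r x) \<le> norm (?B x)"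
  proof (intro AE_I2)
    fix x :: 'a
    have "(norm (x - m))\<^sup>2 / (2 * v) \<le> (norm x)\<^sup>2 / v + (norm m)\<^sup>2 / v"
      using norm_diff_square_le[of x m] v by (simp add: field_simps)
    moreover have "0 \<le> (norm (x - m))\<^sup>2 / (2 * v)"
      using v by simp
    ultimately have "\<bar>ln (r x / gaussian_density m v x)\<bar> \<le> \<bar>ln (r x)\<bar> + ((norm x)\<^sup>2 / v + (norm m)\<^sup>2 / v) + \<bar>c\<bar>"
      unfolding ln_div_gaussian_density[OF v r_pos] c_def[symmetric] by linarith
    from mult_left_mono[OF this less_imp_le[OF r_pos[of x]]]
    have "\<bar>ln (r x / gaussian_density m v x) * r x\<bar>
        \<le> r x * \<bar>ln (r x)\<bar> + 1 / v * ((norm x)\<^sup>2 * r x) + ((norm m)\<^sup>2 / v + \<bar>c\<bar>) * r x"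
      using r_pos[of x] by (simp add: abs_mult algebra_simps)
    also have "\<dots> \<le> ?B x"
      using x_abs_ln_bound[OF r_pos[of x], of "norm x"] by (simp add: algebra_simps)
    finally show "norm (ln (r x / gaussian_density m v x) * r x) \<le> norm (?B x)"
      by simp
  qed
qed

section \<open>Entropy dissipation at a fixed time\<close>

text \<open>An instance of \<open>flux_dissipation\<close>. The centre \<open>m\<close> of the
  Gaussian is arbitrary; its distance to the consensus point enters through the constant vector
  \<open>b\<close>, and a / v = lam gives a |b| = lam |M - m|.\<close>

lemma fokker_planck_entropy_dissipation:
  fixes f r :: "'a::euclidean_space \<Rightarrow> real" and m :: 'a and \<alpha> lam \<delta> :: real
  defines "v \<equiv> \<delta>\<^sup>2 / (2 * lam)"
  defines "\<nu> \<equiv> gaussian_density m v"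
  assumes lam: "0 < lam" and \<delta>: "0 < \<delta>"
    and r_pos: "\<And>x. 0 < r x" and r_prob: "prob_space (measure_of_density r)"
    and r_mom: "integrable lborel (\<lambda>x. (norm x)\<^sup>2 * r x)"
    and r_sq: "integrable lborel (\<lambda>x. (r x)\<^sup>2)"
    and r_diff: "\<And>x. r differentiable (at x)" and grad_diff: "\<And>x. gradient r differentiable (at x)"
    and hess_cont: "\<And>i. i \<in> Basis \<Longrightarrow> continuous_on UNIV (\<lambda>x. frechet_derivative (gradient r) (at x) i)"
    and hR_int: "integrable lborel (\<lambda>x. ln (r x / \<nu> x) * fokker_planck_rhs f \<alpha> lam \<delta> r x)"
  shows "fisher_information r \<nu> < \<infinity>"
    and "(LINT x|lborel. ln (r x / \<nu> x) * fokker_planck_rhs f \<alpha> lam \<delta> r x)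
      \<le> - (\<delta>\<^sup>2 / 2) * enn2real (fisher_information r \<nu>)
         + lam * norm (consensus_point f \<alpha> (measure_of_density r) - m)
           * sqrt (enn2real (fisher_information r \<nu>))"
proof -
  have v: "0 < v"
    using lam \<delta> by (simp add: v_def)
  define a where "a = \<delta>\<^sup>2 / 2"
  have a: "0 < a" "a = lam * v"
    using lam \<delta> by (auto simp: a_def v_def)
  define M where "M = consensus_point f \<alpha> (measure_of_density r)"
  \<comment> \<open>With this choice w + b is the gradient of ln r plus (x - M) / v, so a r (w + b)
    is exactly the flux of the equation, whose drift is centred at \<open>M\<close> instead of
    \<open>m\<close>.\<close>
  define b where "b = (1 / v) *\<^sub>R (m - M)"
  define h where "h x = ln (r x / \<nu> x)" for x
  define w where "w x = (1 / r x) *\<^sub>R gradient r x + (1 / v) *\<^sub>R (x - m)" for x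
  define J' where "J' x e = lam *\<^sub>R ((gradient r x \<bullet> e) *\<^sub>R (x - M) + r x *\<^sub>R e)
     + (\<delta>\<^sup>2 / 2) *\<^sub>R frechet_derivative (gradient r) (at x) e" for x e
  define c where "c = ln ((2 * pi * v) powr (- real DIM('a) / 2))"
  define G where "G x = (3 + 6 / v\<^sup>2) * ((norm x)\<^sup>2 * r x)
       + (12 * (r x)\<^sup>2 + 48 * exp (- (norm x)\<^sup>2 / 2) + (6 / v\<^sup>2 * (norm m) ^ 4 + 3 * c\<^sup>2) * r x)" for x
  have r_der: "(r has_derivative (\<lambda>e. gradient r x \<bullet> e)) (at x)" for x
    by (rule has_derivative_gradient[OF r_diff])
  have r_cont: "continuous_on UNIV r"
    using r_der by (meson has_derivative_continuous continuous_at_imp_continuous_on)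
  have grad_der: "(gradient r has_derivative frechet_derivative (gradient r) (at x)) (at x)" for x
    using grad_diff frechet_derivative_works by blast
  have grad_cont: "continuous_on UNIV (gradient r)"
    using grad_der by (meson has_derivative_continuous continuous_at_imp_continuous_on)
  note r_int = prob_density_integral[OF r_prob borel_measurable_continuous_onI[OF r_cont] less_imp_le[OF r_pos]]
  have R_eq: "fokker_planck_rhs f \<alpha> lam \<delta> r x = (\<Sum>i\<in>Basis. J' x i \<bullet> i)" for x
    unfolding J'_def M_def by (rule fokker_planck_rhs_eq[OF r_diff])
  have h_der: "(h has_derivative (\<lambda>e. w x \<bullet> e)) (at x)" for x
  proof -
    have h_eq: "h = (\<lambda>x. ln (r x) + ((x - m) \<bullet> (x - m)) / (2 * v) - c)"
      unfolding h_def[abs_def] \<nu>_def c_def power2_norm_eq_inner[symmetric]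
      by (intro ext ln_div_gaussian_density v r_pos)
    show ?thesis
      unfolding h_eq w_def
      using r_pos[of x] v
      by (auto intro!: derivative_eq_intros r_der
          simp: fun_eq_iff inner_add_left inner_add_right inner_diff_left inner_diff_right inner_commute field_simps)
  qed
  have w_cont: "continuous_on UNIV w"
    unfolding w_def using r_pos by (intro continuous_intros r_cont grad_cont) (metis less_irrefl)
  have J_der: "((\<lambda>x. (a * r x) *\<^sub>R (w x + b)) has_derivative J' x) (at x)" for x
  proof -
    have "(a * r x) *\<^sub>R (w x + b) = lam *\<^sub>R (r x *\<^sub>R (x - M)) + (\<delta>\<^sup>2 / 2) *\<^sub>R gradient r x" for x
    proof -
      have "w x + b = (1 / r x) *\<^sub>R gradient r x + (1 / v) *\<^sub>R (x - M)"
        by (simp add: w_def b_def algebra_simps)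
      moreover have "a * r x * (1 / r x) = \<delta>\<^sup>2 / 2" "a * r x * (1 / v) = lam * r x"
        using r_pos[of x] v a by (simp_all add: a_def)
      ultimately show ?thesis
        by (simp only: scaleR_add_right scaleR_scaleR) simp
    qed
    moreover have "((\<lambda>x. lam *\<^sub>R (r x *\<^sub>R (x - M)) + (\<delta>\<^sup>2 / 2) *\<^sub>R gradient r x) has_derivative J' x) (at x)"
      unfolding J'_def[abs_def]
      by (auto intro!: derivative_eq_intros r_der grad_der simp: fun_eq_iff scaleR_add_right)
    ultimately show ?thesis
      by presburger
  qed
  have J'_cont: "continuous_on UNIV (\<lambda>x. J' x i)" if "i \<in> Basis" for i
    unfolding J'_def by (intro continuous_intros grad_cont r_cont hess_cont that)
  have G_int: "integrable lborel G"
    unfolding G_def by (intro Bochner_Integration.integrable_add integrable_mult_right r_int r_mom r_sq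
        integrable_exp_neg_norm_square)
  have G_bound: "r x * (h x / real (Suc n))\<^sup>2 \<le> G x" if "norm x \<le> real (Suc n)" for n x
    unfolding h_def \<nu>_def G_def
    by (rule ln_div_gaussian_square_bound[OF v r_pos _ that c_def]) simp
  note flux = flux_dissipation[OF a(1) r_pos r_cont r_int h_der w_cont J_der J'_cont
      hR_int[folded h_def, unfolded R_eq] G_int G_bound]
  have w_int: "integrable lborel (\<lambda>x. r x * (norm (w x))\<^sup>2)"
    by (rule flux(1))
  have diss: "(LINT x|lborel. h x * (\<Sum>i\<in>Basis. J' x i \<bullet> i))
      \<le> - a * (LINT x|lborel. r x * (norm (w x))\<^sup>2)
         + a * norm b * sqrt (LINT x|lborel. r x * (norm (w x))\<^sup>2)"
    by (rule flux(2))
  have grad_eq: "gradient (\<lambda>y. ln (r y / \<nu> y)) x = w x" for x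
    using gradient_eqI[OF h_der] by (simp add: h_def[abs_def])
  have "fisher_information r \<nu> = (\<integral>\<^sup>+x. ennreal (r x * (norm (w x))\<^sup>2) \<partial>lborel)"
    unfolding fisher_information_def grad_eq by (simp add: mult.commute)
  also have "\<dots> = ennreal (LINT x|lborel. r x * (norm (w x))\<^sup>2)"
    using w_int less_imp_le[OF r_pos] by (intro nn_integral_eq_integral) auto
  finally have fisher: "fisher_information r \<nu> = ennreal (LINT x|lborel. r x * (norm (w x))\<^sup>2)" .
  then show "fisher_information r \<nu> < \<infinity>"
    by simp
  have "0 \<le> (LINT x|lborel. r x * (norm (w x))\<^sup>2)"
    using less_imp_le[OF r_pos] by (intro Bochner_Integration.integral_nonneg) simp
  then have fisher_real: "enn2real (fisher_information r \<nu>) = (LINT x|lborel. r x * (norm (w x))\<^sup>2)"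
    by (simp add: fisher)
  have ab: "a * norm b = lam * norm (M - m)"
    using v by (simp add: b_def a(2) norm_minus_commute)
  show "(LINT x|lborel. ln (r x / \<nu> x) * fokker_planck_rhs f \<alpha> lam \<delta> r x)
      \<le> - (\<delta>\<^sup>2 / 2) * enn2real (fisher_information r \<nu>)
         + lam * norm (consensus_point f \<alpha> (measure_of_density r) - m)
           * sqrt (enn2real (fisher_information r \<nu>))"
    using diss[unfolded ab] unfolding fisher_real a_def h_def R_eq M_def .
qed

section \<open>Time derivative of the relative entropy along a solution\<close>

text \<open>The first two conjuncts rule out default values: the entropy is not the 0 of a
  non-integrable integrand, and \<open>enn2real\<close> is not applied to infinity.\<close>

theorem lemma2p2:
  fixes f :: "'a::euclidean_space \<Rightarrow> real" and xmin :: 'a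
    and \<alpha> lam \<delta> T :: real and \<rho> :: "real \<Rightarrow> 'a \<Rightarrow> real" and \<rho>inf :: "'a \<Rightarrow> real"
  assumes "objective_function f xmin"
    and "\<alpha> > 0" and "lam > 0" and "\<delta> > 0" and "T > 0"
    and "smooth_solution f \<alpha> lam \<delta> T \<rho>"
    and "\<rho>inf = gaussian_density xmin (\<delta>\<^sup>2 / (2 * lam))"
  shows "\<forall>t\<in>{0<..T}.
    integrable lborel (\<lambda>x. ln (\<rho> t x / \<rho>inf x) * \<rho> t x) \<and>
    fisher_information (\<rho> t) \<rho>inf < \<infinity> \<and>
    (\<exists>D. ((\<lambda>s. relative_entropy (\<rho> s) \<rho>inf) has_real_derivative D) (at t within {0<..T}) \<and>
       D \<le> - (\<delta>\<^sup>2 / 2) * enn2real (fisher_information (\<rho> t) \<rho>inf)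
           + lam * norm (consensus_point f \<alpha> (measure_of_density (\<rho> t)) - xmin)
             * sqrt (enn2real (fisher_information (\<rho> t) \<rho>inf)))"
proof
  fix t assume t: "t \<in> {0<..T}"
  define v where "v = \<delta>\<^sup>2 / (2 * lam)"
  have v: "0 < v"
    using assms(3,4) by (simp add: v_def)
  have \<rho>inf: "\<rho>inf = gaussian_density xmin v"
    using assms(7) by (simp add: v_def)
  have \<rho>inf_pos: "0 < \<rho>inf x" for x
    unfolding \<rho>inf by (rule gaussian_density_pos[OF v])
  let ?R = "\<lambda>s. fokker_planck_rhs f \<alpha> lam \<delta> (\<rho> s)"
  define h where "h s x = ln (\<rho> s x / \<rho>inf x)" for s x
  note sol = assms(6)[unfolded smooth_solution_def]
  have pos: "0 < \<rho> s x" and prob: "prob_space (measure_of_density (\<rho> s))"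
    and mom: "integrable lborel (\<lambda>x. (norm x)\<^sup>2 * \<rho> s x)"
    and sq: "integrable lborel (\<lambda>x. (\<rho> s x)\<^sup>2)"
    and diff: "\<rho> s differentiable (at x)" and grad_diff: "gradient (\<rho> s) differentiable (at x)"
    and time: "((\<lambda>s. \<rho> s x) has_real_derivative ?R s x) (at s within {0<..T})"
    if "s \<in> {0<..T}" for s x
    using sol that by blast+
  \<comment> \<open>Starting at t / 2 leaves a margin to the left of \<open>t\<close> and stays away
    from time 0.\<close>
  obtain g where g: "integrable lborel g"
    "\<And>s x. s \<in> {t/2..T} \<Longrightarrow> \<bar>?R s x\<bar> * (1 + (norm x)\<^sup>2 + \<bar>ln (\<rho> s x)\<bar>) \<le> g x"
  proof -
    have "t / 2 \<in> {0<..T}"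
      using t by auto
    from bspec[OF sol[THEN conjunct2, THEN conjunct2, THEN conjunct2, THEN conjunct2, THEN conjunct2,
        THEN conjunct2] this]
    obtain g where "integrable lborel g"
      "\<forall>s\<in>{t/2..T}. \<forall>x. \<bar>?R s x\<bar> * (1 + (norm x)\<^sup>2 + \<bar>ln (\<rho> s x)\<bar>) \<le> g x"
      by blast
    then show ?thesis
      by (intro that) auto
  qed
  have hess_cont: "continuous_on UNIV (\<lambda>x. frechet_derivative (gradient (\<rho> s)) (at x) i)"
    if "s \<in> {0<..T}" "i \<in> Basis" for s i
  proof -
    have "continuous_on ({0<..T} \<times> UNIV) (\<lambda>(t, x). frechet_derivative (gradient (\<rho> t)) (at x) i)"
      using sol that(2) by blast
    then have "continuous_on UNIV (\<lambda>x. (\<lambda>(t, x). frechet_derivative (gradient (\<rho> t)) (at x) i) (s, x))"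
      by (rule continuous_on_compose2)
         (intro continuous_on_Pair continuous_on_const continuous_on_id, use that(1) in blast)
    then show ?thesis
      by simp
  qed
  have \<rho>_cont: "continuous_on UNIV (\<rho> s)" if "s \<in> {0<..T}" for s
    by (intro continuous_at_imp_continuous_on ballI differentiable_imp_continuous_within diff that)
  have \<rho>_meas [measurable]: "\<rho> s \<in> borel_measurable borel" if "s \<in> {0<..T}" for s
    by (rule borel_measurable_continuous_onI[OF \<rho>_cont[OF that]])
  have \<rho>_int: "integrable lborel (\<rho> s)" "(LINT x|lborel. \<rho> s x) = 1" if "s \<in> {0<..T}" for s
    using prob_density_integral[OF prob[OF that] \<rho>_meas[OF that]] less_imp_le[OF pos[OF that]] by blast+
  have h_int: "integrable lborel (\<lambda>x. h s x * \<rho> s x)" if "s \<in> {0<..T}" for s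
    unfolding h_def \<rho>inf
    by (rule integrable_ln_div_gaussian[OF v pos \<rho>_meas \<rho>_int(1) mom sq]) (rule that)+
  have R_meas [measurable]: "?R t \<in> borel_measurable borel"
  proof -
    have "continuous_on UNIV (gradient (\<rho> t))"
      by (intro continuous_at_imp_continuous_on ballI differentiable_imp_continuous_within grad_diff t)
    then have "continuous_on UNIV (?R t)"
      unfolding fokker_planck_rhs_eq[OF diff[OF t], abs_def]
      by (intro continuous_intros \<rho>_cont hess_cont t)
    then show ?thesis
      by (rule borel_measurable_continuous_onI)
  qed
  have h_meas [measurable]: "h t \<in> borel_measurable borel"
    using \<rho>_meas[OF t] unfolding h_def[abs_def] \<rho>inf gaussian_density_def by measurable
  define c where "c = ln ((2 * pi * v) powr (- real DIM('a) / 2))"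
  \<comment> \<open>Large enough to majorise all coefficients in the bound for |h| + 1: the constant
    part, 1 / v in front of |x|^2, and 1 in front of the logarithm.\<close>
  define C where "C = 1 + 1 / v + (norm xmin)\<^sup>2 / v + \<bar>c\<bar>"
  have C1: "1 \<le> C"
    using v by (simp add: C_def)
  have h_bound: "\<bar>h s x\<bar> + 1 \<le> C * (1 + (norm x)\<^sup>2 + \<bar>ln (\<rho> s x)\<bar>)" if "s \<in> {0<..T}" for s x
  proof -
    have "(norm (x - xmin))\<^sup>2 / (2 * v) \<le> (norm x)\<^sup>2 / v + (norm xmin)\<^sup>2 / v"
      using norm_diff_square_le[of x xmin] v by (simp add: field_simps)
    moreover have "0 \<le> (norm (x - xmin))\<^sup>2 / (2 * v)"
      using v by simp
    ultimately have "\<bar>h s x\<bar> \<le> \<bar>ln (\<rho> s x)\<bar> + ((norm x)\<^sup>2 / v + (norm xmin)\<^sup>2 / v) + \<bar>c\<bar>"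
      unfolding h_def \<rho>inf ln_div_gaussian_density[OF v pos[OF that]] c_def[symmetric] by linarith
    moreover have "0 \<le> 1 / v"
      using v by simp
    ultimately have "\<bar>h s x\<bar> + 1 \<le> C + (norm x)\<^sup>2 / v + \<bar>ln (\<rho> s x)\<bar>"
      unfolding C_def by linarith
    also have "\<dots> = C * 1 + 1 / v * (norm x)\<^sup>2 + 1 * \<bar>ln (\<rho> s x)\<bar>"
      by simp
    also have "\<dots> \<le> C * 1 + C * (norm x)\<^sup>2 + C * \<bar>ln (\<rho> s x)\<bar>"
      using C1 v by (intro add_mono mult_right_mono order_refl) (simp_all add: C_def)
    also have "\<dots> = C * (1 + (norm x)\<^sup>2 + \<bar>ln (\<rho> s x)\<bar>)"
      by (simp only: ring_distribs)
    finally show ?thesis .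
  qed
  \<comment> \<open>The weight |h| + 1 is dictated by the time derivative of h \<rho>, which is h R
    + R with R the right-hand side of the equation.\<close>
  have dom: "\<bar>?R s x\<bar> * (\<bar>h s x\<bar> + 1) \<le> C * g x" if s: "s \<in> {t/2..T}" for s x
  proof -
    have "s \<in> {0<..T}" using s t by auto
    from mult_left_mono[OF h_bound[OF this, of x] abs_ge_zero[of "?R s x"]]
    have "\<bar>?R s x\<bar> * (\<bar>h s x\<bar> + 1) \<le> C * (\<bar>?R s x\<bar> * (1 + (norm x)\<^sup>2 + \<bar>ln (\<rho> s x)\<bar>))"
      by (simp only: mult.left_commute)
    also have "\<dots> \<le> C * g x"
      using C1 g(2)[OF s, of x] by (intro mult_left_mono) auto
    finally show ?thesis .
  qed
  have domR: "\<bar>?R s x\<bar> \<le> C * g x" and domhR: "\<bar>h s x * ?R s x\<bar> \<le> C * g x" if s: "s \<in> {t/2..T}" for s x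
  proof -
    have "\<bar>?R s x\<bar> * (\<bar>h s x\<bar> + 1) = \<bar>h s x * ?R s x\<bar> + \<bar>?R s x\<bar>"
      by (simp add: abs_mult ring_distribs mult.commute)
    then show "\<bar>?R s x\<bar> \<le> C * g x" "\<bar>h s x * ?R s x\<bar> \<le> C * g x"
      using dom[OF s, of x] by auto
  qed
  have Cg: "integrable lborel (\<lambda>x. C * g x)"
    using g(1) by simp
  have t_mem: "t \<in> {t/2..T}" "t / 2 \<in> {0<..<t}"
    using t by auto
  have R_int: "integrable lborel (?R t)"
    by (rule Bochner_Integration.integrable_bound[OF Cg])
       (simp, intro AE_I2, unfold real_norm_def, rule order_trans[OF domR[OF t_mem(1)] abs_ge_self])
  have hR_int: "integrable lborel (\<lambda>x. h t x * ?R t x)"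
    by (rule Bochner_Integration.integrable_bound[OF Cg])
       (simp, intro AE_I2, unfold real_norm_def, rule order_trans[OF domhR[OF t_mem(1)] abs_ge_self])
  \<comment> \<open>Conservation of mass: the total mass is constantly 1, so its derivative
    vanishes. Derivatives within \<open>{0<..T}\<close> are unique because \<open>t\<close> is a
    limit point of that set, at \<open>t = T\<close> from the left.\<close>
  have R_0: "(LINT x|lborel. ?R t x) = 0"
  proof -
    have "((\<lambda>s. LINT x|lborel. \<rho> s x) has_real_derivative (LINT x|lborel. ?R t x)) (at t within {0<..T})"
      by (rule has_real_derivative_integral[OF time \<rho>_int(1) _ t t_mem(2) Cg domR]) simp_all
    then have lim: "((\<lambda>s. ((LINT x|lborel. \<rho> s x) - (LINT x|lborel. \<rho> t x)) / (s - t))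
        \<longlongrightarrow> (LINT x|lborel. ?R t x)) (at t within {0<..T})"
      by (simp add: has_field_derivative_iff)
    have zero: "((\<lambda>s. ((LINT x|lborel. \<rho> s x) - (LINT x|lborel. \<rho> t x)) / (s - t))
        \<longlongrightarrow> 0) (at t within {0<..T})"
      by (rule tendsto_eventually) (simp add: eventually_at_filter \<rho>_int(2) \<rho>_int(2)[OF t])
    have "t islimpt {0<..<t}"
      using t by (simp add: islimpt_greaterThanLessThan2)
    then have "t islimpt {0<..T}"
      by (rule islimpt_subset) (use t in auto)
    then have "at t within {0<..T} \<noteq> bot"
      by (simp add: trivial_limit_within)
    then show ?thesis
      using tendsto_unique lim zero by blast
  qed
  have "((\<lambda>s. LINT x|lborel. h s x * \<rho> s x) has_real_derivative
      (LINT x|lborel. h t x * ?R t x + ?R t x)) (at t within {0<..T})"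
  proof (rule has_real_derivative_integral[OF _ h_int _ t t_mem(2) Cg])
    show "((\<lambda>s. h s x * \<rho> s x) has_real_derivative h s x * ?R s x + ?R s x) (at s within {0<..T})"
      if s: "s \<in> {0<..T}" for s x
      unfolding h_def using pos[OF s, of x] \<rho>inf_pos[of x]
      by (auto intro!: derivative_eq_intros time[OF s] simp: field_simps)
    show "\<bar>h s x * ?R s x + ?R s x\<bar> \<le> C * g x" if "s \<in> {t/2..T}" for s x
    proof -
      have "\<bar>?R s x\<bar> * (\<bar>h s x\<bar> + 1) = \<bar>h s x * ?R s x\<bar> + \<bar>?R s x\<bar>"
        by (simp add: abs_mult ring_distribs mult.commute)
      then show ?thesis
        using dom[OF that, of x] by linarith
    qed
    show "(\<lambda>x. h t x * ?R t x + ?R t x) \<in> borel_measurable lborel"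
      using R_int hR_int by simp
  qed
  also have "(LINT x|lborel. h t x * ?R t x + ?R t x) = (LINT x|lborel. h t x * ?R t x)"
    using hR_int R_int R_0 by simp
  finally have deriv: "((\<lambda>s. relative_entropy (\<rho> s) \<rho>inf) has_real_derivative
      (LINT x|lborel. h t x * ?R t x)) (at t within {0<..T})"
    unfolding relative_entropy_def h_def .
  note diss = fokker_planck_entropy_dissipation[OF assms(3,4) pos[OF t] prob[OF t] mom[OF t] sq[OF t]
      diff[OF t] grad_diff[OF t] hess_cont[OF t] hR_int[unfolded h_def assms(7)], folded assms(7)]
  show "integrable lborel (\<lambda>x. ln (\<rho> t x / \<rho>inf x) * \<rho> t x) \<and>
    fisher_information (\<rho> t) \<rho>inf < \<infinity> \<and>
    (\<exists>D. ((\<lambda>s. relative_entropy (\<rho> s) \<rho>inf) has_real_derivative D) (at t within {0<..T}) \<and>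
       D \<le> - (\<delta>\<^sup>2 / 2) * enn2real (fisher_information (\<rho> t) \<rho>inf)
           + lam * norm (consensus_point f \<alpha> (measure_of_density (\<rho> t)) - xmin)
             * sqrt (enn2real (fisher_information (\<rho> t) \<rho>inf)))"
  proof (intro conjI exI)
    show "integrable lborel (\<lambda>x. ln (\<rho> t x / \<rho>inf x) * \<rho> t x)"
      using h_int[OF t] unfolding h_def .
    show "fisher_information (\<rho> t) \<rho>inf < \<infinity>"
      by (rule diss(1))
    show "((\<lambda>s. relative_entropy (\<rho> s) \<rho>inf) has_real_derivative
        (LINT x|lborel. h t x * ?R t x)) (at t within {0<..T})"
      by (rule deriv)
    show "(LINT x|lborel. h t x * ?R t x)
        \<le> - (\<delta>\<^sup>2 / 2) * enn2real (fisher_information (\<rho> t) \<rho>inf)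
           + lam * norm (consensus_point f \<alpha> (measure_of_density (\<rho> t)) - xmin)
             * sqrt (enn2real (fisher_information (\<rho> t) \<rho>inf))"
      unfolding h_def by (rule diss(2))
  qed
qed

end
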